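(* Let $A=\mathrm{Free}(k)/I$ be an MV-algebra and let $m\in\mathbb N$. The following are equivalent: (1) $A\in\mathbb V(K_m)$; (2) every ideal $P\in\mathrm{Spec}(A)$ has rank a divisor of $m$; (3) every ideal $M\in\mathrm{Max}(A)$ has rank a divisor of $m$; (4) every element of $V(I)$ has rank a divisor of $m$.
   Context: An MV-algebra is a structure $(A,\oplus,0,\neg)$ such that $(A,\oplus,0)$ is a commutative monoid, $\neg\neg x=x$, $x\oplus\neg 0=\neg 0$, and $\neg(\neg x\oplus y)\oplus y=\neg(\neg y\oplus x)\oplus x$. It is a lattice with $x\vee y=\neg(\neg x\oplus y)\oplus y$ and $x\wedge y=\neg(\neg x\vee\neg y)$. An ideal of $A$ is a nonempty subset that is downward closed and closed under $\oplus$; an ideal $P\neq A$ is prime if $x\wedge y\in P$ implies $x\in P$ or $y\in P$. $\mathrm{Spec}(A)$ is the set of prime ideals of $A$ and $\mathrm{Max}(A)$ is the set of maximal ideals of $A$. $\mathrm{Free}(k)$ is the free MV-algebra over $k$ generators ($k$ a possibly infinite cardinal), $I$ is an ideal of $\mathrm{Free}(k)$, and $V(I)=\{P\in\mathrm{Spec}(\mathrm{Free}(k)) : I\subseteq P\}$. For a lattice ordered abelian group $G$ with strong unit $u$, $\Gamma(G,u)$ is the MV-algebra on $[0,u]=\{a\in G: 0\le a\le u\}$ with $a\oplus b=(a+b)\wedge u$, $\neg a=u-a$, and zero element the identity $0$ of $G$. $K_m=\Gamma(\mathbb Z\ \mathrm{lex}\ \mathbb Z,(m,0))$ is the $m$-th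 Komori chain, where lex denotes the lexicographic product, and $\mathbb V(K_m)$ is the variety of MV-algebras generated by $K_m$. $\mathrm{Rad}(B)$ is the intersection of all maximal ideals of an MV-algebra $B$. The rank of an MV-algebra $B$ is the cardinality of $B/\mathrm{Rad}(B)$, that is, the number of radical classes (equivalence classes modulo the radical). The rank of a prime ideal $P\in\mathrm{Spec}(B)$ is the rank of the chain $B/P$.
   Formalization: The rank is taken to be the number of radical classes minus one (so K_m has rank m): with rank equal to the cardinality of B/Rad(B) the claim fails for the two-element algebra and m=1. Also m≥1, so that (m,0) is a strong unit. *)

theory Defs
  imports
    Main
    "HOL-Library.Lattice_Algebras"
    "HOL-Library.Product_Plus"
    "HOL-Library.Product_Lexorder"
    "HOL-Algebra.Congruence"
begin

section \<open>MV-algebras\<close>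

record 'a mv = "'a partial_object" +
  mv_plus :: "'a \<Rightarrow> 'a \<Rightarrow> 'a" (infixl "\<oplus>\<index>" 65)
  mv_zero :: 'a ("\<zero>\<index>")
  mv_neg :: "'a \<Rightarrow> 'a"

definition mv_sup :: "'a mv \<Rightarrow> 'a \<Rightarrow> 'a \<Rightarrow> 'a" where
  "mv_sup A x y = mv_neg A (mv_neg A x \<oplus>\<^bsub>A\<^esub> y) \<oplus>\<^bsub>A\<^esub> y"

definition mv_inf :: "'a mv \<Rightarrow> 'a \<Rightarrow> 'a \<Rightarrow> 'a" where
  "mv_inf A x y = mv_neg A (mv_sup A (mv_neg A x) (mv_neg A y))"

definition mv_le :: "'a mv \<Rightarrow> 'a \<Rightarrow> 'a \<Rightarrow> bool" where
  "mv_le A x y \<longleftrightarrow> mv_sup A x y = y"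

locale mv_algebra =
  fixes A :: "'a mv" (structure)
  assumes plus_closed: "\<lbrakk>x \<in> carrier A; y \<in> carrier A\<rbrakk> \<Longrightarrow> x \<oplus> y \<in> carrier A"
    and zero_closed: "\<zero> \<in> carrier A"
    and neg_closed: "x \<in> carrier A \<Longrightarrow> mv_neg A x \<in> carrier A"
    and plus_assoc: "\<lbrakk>x \<in> carrier A; y \<in> carrier A; z \<in> carrier A\<rbrakk>
      \<Longrightarrow> (x \<oplus> y) \<oplus> z = x \<oplus> (y \<oplus> z)"
    and plus_comm: "\<lbrakk>x \<in> carrier A; y \<in> carrier A\<rbrakk> \<Longrightarrow> x \<oplus> y = y \<oplus> x"
    and plus_zero: "x \<in> carrier A \<Longrightarrow> x \<oplus> \<zero> = x"
    and neg_neg: "x \<in> carrier A \<Longrightarrow> mv_neg A (mv_neg A x) = x"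
    and plus_neg_zero: "x \<in> carrier A \<Longrightarrow> x \<oplus> mv_neg A \<zero> = mv_neg A \<zero>"
    and sup_comm: "\<lbrakk>x \<in> carrier A; y \<in> carrier A\<rbrakk> \<Longrightarrow> mv_sup A x y = mv_sup A y x"


section \<open>Ideals\<close>

definition mv_ideal :: "'a mv \<Rightarrow> 'a set \<Rightarrow> bool" where
  "mv_ideal A J \<longleftrightarrow> J \<subseteq> carrier A \<and> J \<noteq> {} \<and>
     (\<forall>x\<in>carrier A. \<forall>y\<in>J. mv_le A x y \<longrightarrow> x \<in> J) \<and>
     (\<forall>x\<in>J. \<forall>y\<in>J. x \<oplus>\<^bsub>A\<^esub> y \<in> J)"

definition mv_Spec :: "'a mv \<Rightarrow> 'a set set" where
  "mv_Spec A = {P. mv_ideal A P \<and> P \<noteq> carrier A \<and>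
     (\<forall>x\<in>carrier A. \<forall>y\<in>carrier A. mv_inf A x y \<in> P \<longrightarrow> x \<in> P \<or> y \<in> P)}"

definition mv_Max :: "'a mv \<Rightarrow> 'a set set" where
  "mv_Max A = {M. mv_ideal A M \<and> M \<noteq> carrier A \<and>
     (\<forall>J. mv_ideal A J \<and> J \<noteq> carrier A \<and> M \<subseteq> J \<longrightarrow> J = M)}"

definition mv_V :: "'a mv \<Rightarrow> 'a set \<Rightarrow> 'a set set" where
  "mv_V A I = {P \<in> mv_Spec A. I \<subseteq> P}"

text \<open>The one-element algebra has no maximal ideals; its radical is its carrier.\<close>

definition mv_Rad :: "'a mv \<Rightarrow> 'a set" where
  "mv_Rad A = {x \<in> carrier A. \<forall>M\<in>mv_Max A. x \<in> M}"


section \<open>Quotients and rank\<close>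

text \<open>Quotient by an equivalence relation \<open>r\<close> on the carrier that is compatible with the
  operations; its elements are the equivalence classes.\<close>

definition mv_quot :: "'a mv \<Rightarrow> 'a rel \<Rightarrow> 'a set mv" where
  "mv_quot A r =
    \<lparr>carrier = carrier A // r,
     mv_plus = (\<lambda>C D. r `` {x \<oplus>\<^bsub>A\<^esub> y | x y. x \<in> C \<and> y \<in> D}),
     mv_zero = r `` {\<zero>\<^bsub>A\<^esub>},
     mv_neg = (\<lambda>C. r `` (mv_neg A ` C))\<rparr>"

text \<open>The congruence of an ideal \<open>J\<close>: the distance \<open>(x \<ominus> y) \<oplus> (y \<ominus> x)\<close> lies in \<open>J\<close>, where
  \<open>x \<ominus> y = \<not>(\<not>x \<oplus> y)\<close>.\<close>

definition mv_minus :: "'a mv \<Rightarrow> 'a \<Rightarrow> 'a \<Rightarrow> 'a" where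
  "mv_minus A x y = mv_neg A (mv_neg A x \<oplus>\<^bsub>A\<^esub> y)"

definition ideal_cong :: "'a mv \<Rightarrow> 'a set \<Rightarrow> 'a rel" where
  "ideal_cong A J = {(x, y). x \<in> carrier A \<and> y \<in> carrier A \<and>
     mv_minus A x y \<oplus>\<^bsub>A\<^esub> mv_minus A y x \<in> J}"

definition mv_ideal_quot :: "'a mv \<Rightarrow> 'a set \<Rightarrow> 'a set mv" where
  "mv_ideal_quot A J = mv_quot A (ideal_cong A J)"

definition radical_classes :: "'a mv \<Rightarrow> 'a set set" where
  "radical_classes B = carrier (mv_ideal_quot B (mv_Rad B))"

text \<open>The rank counts the radical classes, with the normalization under which the Lukasiewicz
  chain \<open>{0, 1/n, ..., 1}\<close> and the \<open>n\<close>-th Komori chain have rank \<open>n\<close>: rank \<open>n\<close> means exactly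
  \<open>n + 1\<close> radical classes (see \<open>has_rank_Komori\<close> below). This is the normalization for which
  ranks are compared with \<open>m\<close> by divisibility. For instance the two-element algebra, which has
  two radical classes and lies in every nontrivial variety of MV-algebras, must have rank \<open>1\<close>.
  An algebra with infinitely many radical classes has no finite rank.\<close>

definition has_rank :: "'a mv \<Rightarrow> nat \<Rightarrow> bool" where
  "has_rank B n \<longleftrightarrow> finite (radical_classes B) \<and> card (radical_classes B) = n + 1"

definition ideal_has_rank :: "'a mv \<Rightarrow> 'a set \<Rightarrow> nat \<Rightarrow> bool" where
  "ideal_has_rank B P n \<longleftrightarrow> has_rank (mv_ideal_quot B P) n"


section \<open>Terms, free algebras and varieties\<close>

datatype (vars: 'v) mv_term =
    Var 'v
  | Zero
  | Plus "'v mv_term" "'v mv_term"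
  | Neg "'v mv_term"

text \<open>Equality of terms derivable from the MV-algebra axioms.\<close>

inductive mv_equal :: "'v mv_term \<Rightarrow> 'v mv_term \<Rightarrow> bool" where
  refl: "mv_equal s s"
| sym: "mv_equal s t \<Longrightarrow> mv_equal t s"
| trans: "mv_equal s t \<Longrightarrow> mv_equal t u \<Longrightarrow> mv_equal s u"
| Plus_cong: "mv_equal s s' \<Longrightarrow> mv_equal t t' \<Longrightarrow> mv_equal (Plus s t) (Plus s' t')"
| Neg_cong: "mv_equal s s' \<Longrightarrow> mv_equal (Neg s) (Neg s')"
| assoc: "mv_equal (Plus (Plus s t) u) (Plus s (Plus t u))"
| comm: "mv_equal (Plus s t) (Plus t s)"
| zero: "mv_equal (Plus s Zero) s"
| neg_neg: "mv_equal (Neg (Neg s)) s"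
| neg_zero: "mv_equal (Plus s (Neg Zero)) (Neg Zero)"
| sup_comm: "mv_equal (Plus (Neg (Plus (Neg s) t)) t) (Plus (Neg (Plus (Neg t) s)) s)"

definition term_alg :: "'v set \<Rightarrow> 'v mv_term mv" where
  "term_alg X = \<lparr>carrier = {t. vars t \<subseteq> X}, mv_plus = Plus, mv_zero = Zero, mv_neg = Neg\<rparr>"

text \<open>The free MV-algebra with the elements of \<open>X\<close> (the classes of \<open>Var x\<close>) as free
  generators; \<open>X\<close> may be empty, finite or infinite.\<close>

definition Free_cong :: "'v set \<Rightarrow> 'v mv_term rel" where
  "Free_cong X = {(s, t). vars s \<subseteq> X \<and> vars t \<subseteq> X \<and> mv_equal s t}"

definition Free :: "'v set \<Rightarrow> 'v mv_term set mv" where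
  "Free X = mv_quot (term_alg X) (Free_cong X)"

lemma mv_algebra_Free: "mv_algebra (Free X)"
proof -
  let ?r = "Free_cong X"
  define c where "c t = ?r `` {t}" for t
  have eq: "equiv {t. vars t \<subseteq> X} ?r"
    by (auto simp: equiv_def refl_on_def sym_on_def trans_on_def Free_cong_def intro: mv_equal.intros)
  have c_eq: "c s = c t" if "vars s \<subseteq> X" "vars t \<subseteq> X" "mv_equal s t" for s t
    unfolding c_def using that by (intro equiv_class_eq[OF eq]) (simp add: Free_cong_def)
  have self: "t \<in> c t" if "vars t \<subseteq> X" for t
    using that by (auto simp: c_def Free_cong_def intro: mv_equal.refl)
  have D: "s \<in> c t \<Longrightarrow> vars s \<subseteq> X \<and> mv_equal t s" for s t
    by (auto simp: c_def Free_cong_def)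
  have im: "?r `` S = c t" if "t \<in> S" "vars t \<subseteq> X" "\<And>s. s \<in> S \<Longrightarrow> vars s \<subseteq> X \<and> mv_equal t s" for S t
    using that c_eq unfolding c_def by blast
  have carr: "carrier (Free X) = {c t | t. vars t \<subseteq> X}"
    by (auto simp: Free_def mv_quot_def term_alg_def quotient_def c_def)
  have plus: "c s \<oplus>\<^bsub>Free X\<^esub> c t = c (Plus s t)" if "vars s \<subseteq> X" "vars t \<subseteq> X" for s t
  proof -
    have "?r `` {Plus x y | x y. x \<in> c s \<and> y \<in> c t} = c (Plus s t)"
    proof (rule im)
      show "Plus s t \<in> {Plus x y | x y. x \<in> c s \<and> y \<in> c t}" using that self by blast
    qed (use that in \<open>auto dest: D D[THEN conjunct1, THEN subsetD] intro: mv_equal.Plus_cong\<close>)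
    then show ?thesis by (simp add: Free_def mv_quot_def term_alg_def)
  qed
  have neg: "mv_neg (Free X) (c t) = c (Neg t)" if "vars t \<subseteq> X" for t
  proof -
    have "?r `` (Neg ` c t) = c (Neg t)"
    proof (rule im)
      show "Neg t \<in> Neg ` c t" using that self by blast
    qed (use that in \<open>auto dest: D D[THEN conjunct1, THEN subsetD] intro: mv_equal.Neg_cong\<close>)
    then show ?thesis by (simp add: Free_def mv_quot_def term_alg_def)
  qed
  have zero: "\<zero>\<^bsub>Free X\<^esub> = c Zero"
    by (simp add: Free_def mv_quot_def term_alg_def c_def)
  show ?thesis
  proof
    fix x y z assume "x \<in> carrier (Free X)" "y \<in> carrier (Free X)" "z \<in> carrier (Free X)"
    then show "(x \<oplus>\<^bsub>Free X\<^esub> y) \<oplus>\<^bsub>Free X\<^esub> z = x \<oplus>\<^bsub>Free X\<^esub> (y \<oplus>\<^bsub>Free X\<^esub> z)"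
      by (clarsimp simp: carr plus) (rule c_eq, simp_all add: mv_equal.assoc)
  next
    fix x y assume xy: "x \<in> carrier (Free X)" "y \<in> carrier (Free X)"
    from xy obtain s t where [simp]: "x = c s" "y = c t" "vars s \<subseteq> X" "vars t \<subseteq> X"
      by (auto simp: carr)
    show "x \<oplus>\<^bsub>Free X\<^esub> y \<in> carrier (Free X)"
      by (simp add: carr plus) (rule exI[of _ "Plus s t"], simp)
    show "x \<oplus>\<^bsub>Free X\<^esub> y = y \<oplus>\<^bsub>Free X\<^esub> x"
      by (simp add: plus c_eq mv_equal.comm)
    show "mv_sup (Free X) x y = mv_sup (Free X) y x"
      by (simp add: mv_sup_def plus neg) (rule c_eq, simp_all add: mv_equal.sup_comm)
  next
    fix x assume x: "x \<in> carrier (Free X)"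
    from x obtain s where [simp]: "x = c s" "vars s \<subseteq> X" by (auto simp: carr)
    show "mv_neg (Free X) x \<in> carrier (Free X)"
      by (simp add: carr neg) (rule exI[of _ "Neg s"], simp)
    show "x \<oplus>\<^bsub>Free X\<^esub> \<zero>\<^bsub>Free X\<^esub> = x"
      by (simp add: plus zero c_eq mv_equal.zero)
    show "mv_neg (Free X) (mv_neg (Free X) x) = x"
      by (simp add: neg c_eq mv_equal.neg_neg)
    show "x \<oplus>\<^bsub>Free X\<^esub> mv_neg (Free X) \<zero>\<^bsub>Free X\<^esub> = mv_neg (Free X) \<zero>\<^bsub>Free X\<^esub>"
      by (simp add: plus neg zero c_eq mv_equal.neg_zero)
  next
    show "\<zero>\<^bsub>Free X\<^esub> \<in> carrier (Free X)"
      by (auto simp: carr zero intro!: exI[of _ Zero])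
  qed
qed

fun mv_eval :: "'a mv \<Rightarrow> ('v \<Rightarrow> 'a) \<Rightarrow> 'v mv_term \<Rightarrow> 'a" where
  "mv_eval A f (Var x) = f x"
| "mv_eval A f Zero = \<zero>\<^bsub>A\<^esub>"
| "mv_eval A f (Plus s t) = mv_eval A f s \<oplus>\<^bsub>A\<^esub> mv_eval A f t"
| "mv_eval A f (Neg s) = mv_neg A (mv_eval A f s)"

lemma mv_eval_closed:
  "mv_algebra A \<Longrightarrow> f \<in> UNIV \<rightarrow> carrier A \<Longrightarrow> mv_eval A f t \<in> carrier A"
  by (induction t) (auto simp: mv_algebra.plus_closed mv_algebra.neg_closed mv_algebra.zero_closed)

lemma mv_equal_sound:
  assumes "mv_equal s t" "mv_algebra A" "f \<in> UNIV \<rightarrow> carrier A"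
  shows "mv_eval A f s = mv_eval A f t"
proof -
  interpret mv_algebra A by fact
  note [simp] = mv_eval_closed[OF assms(2,3)]
  show ?thesis using assms(1)
  proof induction
    case (comm s t) show ?case by (simp add: plus_comm)
  next
    case (sup_comm s t)
    show ?case using mv_algebra.sup_comm[OF assms(2), of "mv_eval A f s" "mv_eval A f t"]
      by (simp add: mv_sup_def)
  qed (auto simp: plus_assoc plus_zero neg_neg plus_neg_zero)
qed

text \<open>Sets of identities, in countably many variables.\<close>

definition satisfies :: "'a mv \<Rightarrow> (nat mv_term \<times> nat mv_term) set \<Rightarrow> bool" where
  "satisfies A E \<longleftrightarrow>
     (\<forall>(s, t)\<in>E. \<forall>f\<in>UNIV \<rightarrow> carrier A. mv_eval A f s = mv_eval A f t)"

text \<open>A variety is an equationally definable class of MV-algebras; \<open>A\<close> belongs to the variety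
  generated by \<open>K\<close> if it belongs to every variety that contains \<open>K\<close>.\<close>

definition in_variety_of :: "'b mv \<Rightarrow> 'a mv \<Rightarrow> bool" where
  "in_variety_of K A \<longleftrightarrow> mv_algebra A \<and> (\<forall>E. satisfies K E \<longrightarrow> satisfies A E)"


section \<open>Komori chains\<close>

instance prod :: (linordered_ab_group_add, linordered_ab_group_add) linordered_ab_group_add
  by standard (auto simp: less_eq_prod_def)

instance prod :: (linordered_ab_group_add, linordered_ab_group_add) lattice_ab_group_add
  by standard

definition strong_unit :: "'a::lattice_ab_group_add \<Rightarrow> bool" where
  "strong_unit u \<longleftrightarrow> 0 \<le> u \<and> (\<forall>a. \<exists>n. a \<le> (((+) u) ^^ n) 0)"

definition Gamma :: "'a::lattice_ab_group_add \<Rightarrow> 'a mv" where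
  "Gamma u =
    \<lparr>carrier = {0..u},
     mv_plus = (\<lambda>a b. inf (a + b) u),
     mv_zero = 0,
     mv_neg = (\<lambda>a. u - a)\<rparr>"

text \<open>The order on \<^typ>\<open>int \<times> int\<close> is lexicographic.\<close>

definition Komori :: "nat \<Rightarrow> (int \<times> int) mv" where
  "Komori m = Gamma (int m, 0)"

lemma mv_algebra_Gamma:
  assumes "strong_unit u"
  shows "mv_algebra (Gamma u)"
proof -
  have u: "0 \<le> u" using assms by (simp add: strong_unit_def)
  have sup: "mv_sup (Gamma u) x y = sup x y" if "0 \<le> x" "x \<le> u" "0 \<le> y" "y \<le> u" for x y
  proof -
    have "u - inf (u - x + y) u = sup (x - y) 0"
      by (simp add: diff_inf_eq_sup add_sup_distrib_left algebra_simps)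
    then have "mv_sup (Gamma u) x y = inf (sup (x - y) 0 + y) u"
      by (simp add: mv_sup_def Gamma_def)
    also have "sup (x - y) 0 + y = sup x y"
      by (simp add: add_sup_distrib_right)
    finally show ?thesis using that by (simp add: inf_absorb1)
  qed
  have step: "inf (inf (a + b) u + c) u = inf (a + b + c) u" if "0 \<le> c" for a b c
  proof -
    have "inf (inf (a + b) u + c) u = inf (a + b + c) (inf (u + c) u)"
      by (simp add: add_inf_distrib_right inf_assoc)
    also have "inf (u + c) u = u" using that by (simp add: inf_absorb2)
    finally show ?thesis .
  qed
  show ?thesis
  proof
    fix x y z assume "x \<in> carrier (Gamma u)" "y \<in> carrier (Gamma u)" "z \<in> carrier (Gamma u)"
    then show "(x \<oplus>\<^bsub>Gamma u\<^esub> y) \<oplus>\<^bsub>Gamma u\<^esub> z = x \<oplus>\<^bsub>Gamma u\<^esub> (y \<oplus>\<^bsub>Gamma u\<^esub> z)"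
      using step[of z x y] step[of x y z] by (simp add: Gamma_def ac_simps)
  next
    fix x y assume "x \<in> carrier (Gamma u)" "y \<in> carrier (Gamma u)"
    then show "mv_sup (Gamma u) x y = mv_sup (Gamma u) y x"
      using sup[of x y] sup[of y x] by (simp add: Gamma_def sup_commute)
  qed (use u in \<open>auto simp: Gamma_def add_nonneg_nonneg add.commute inf_absorb1 inf_absorb2\<close>)
qed

lemma strong_unit_Komori:
  assumes "m > 0"
  shows "strong_unit (int m, 0 :: int)"
proof -
  have it: "(((+) (int m, 0 :: int)) ^^ n) 0 = (int n * int m, 0)" for n
    by (induction n) (auto simp: zero_prod_def algebra_simps)
  have "\<exists>n. p \<le> (((+) (int m, 0 :: int)) ^^ n) 0" for p :: "int \<times> int"
  proof -
    have "fst p < int (Suc (nat \<bar>fst p\<bar>)) * 1" by simp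
    also have "\<dots> \<le> int (Suc (nat \<bar>fst p\<bar>)) * int m"
      using assms by (intro mult_left_mono) auto
    finally show ?thesis
      unfolding it by (intro exI[of _ "Suc (nat \<bar>fst p\<bar>)"]) (simp add: less_eq_prod_def)
  qed
  then show ?thesis by (simp add: strong_unit_def zero_prod_def)
qed

lemma mv_algebra_Komori: "m > 0 \<Longrightarrow> mv_algebra (Komori m)"
  unfolding Komori_def by (intro mv_algebra_Gamma strong_unit_Komori)

lemma carrier_Komori:
  "carrier (Komori m) = {p. (0 \<le> fst p \<and> fst p \<le> int m) \<and>
     (fst p = 0 \<longrightarrow> 0 \<le> snd p) \<and> (fst p = int m \<longrightarrow> snd p \<le> 0)}"
  by (auto simp: Komori_def Gamma_def less_eq_prod_def zero_prod_def)

lemma plus_Komori: "p \<oplus>\<^bsub>Komori m\<^esub> q = min (p + q) (int m, 0)"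
  by (simp add: Komori_def Gamma_def inf_prod_def)

lemma neg_Komori: "mv_neg (Komori m) p = (int m, 0) - p"
  by (simp add: Komori_def Gamma_def)

lemma sup_Komori:
  assumes "p \<in> carrier (Komori m)" "q \<in> carrier (Komori m)"
  shows "mv_sup (Komori m) p q = max p q"
  using assms
  by (cases p; cases q)
     (auto simp: mv_sup_def plus_Komori neg_Komori carrier_Komori min_def max_def split: if_splits)

lemma mv_Max_Komori:
  assumes m: "m > 0"
  shows "mv_Max (Komori m) = {{p. fst p = 0 \<and> 0 \<le> snd p}}"
proof -
  let ?K = "Komori m" and ?R = "{p :: int \<times> int. fst p = 0 \<and> 0 \<le> snd p}"
  have le: "mv_le ?K p q \<longleftrightarrow> p \<le> q" if "p \<in> carrier ?K" "q \<in> carrier ?K" for p q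
    using sup_Komori[OF that] by (auto simp: mv_le_def max_def)
  have Rsub: "?R \<subseteq> carrier ?K" using m by (auto simp: carrier_Komori)
  have top: "(int m, 0) \<in> carrier ?K" "(int m, 0) \<notin> ?R" using m by (auto simp: carrier_Komori)
  have R: "mv_ideal ?K ?R"
    unfolding mv_ideal_def
  proof (intro conjI ballI impI)
    fix x y assume "x \<in> carrier ?K" "y \<in> ?R" "mv_le ?K x y"
    then show "x \<in> ?R" using le[of x y] Rsub
      by (auto simp: carrier_Komori less_eq_prod_def)
  next
    fix x y assume "x \<in> ?R" "y \<in> ?R"
    then show "x \<oplus>\<^bsub>?K\<^esub> y \<in> ?R" using m
      by (auto simp: plus_Komori min_def less_eq_prod_def)
  qed (use Rsub in \<open>auto intro: exI[of _ 0]\<close>)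
  have sub: "J \<subseteq> ?R" if J: "mv_ideal ?K J" and ne: "J \<noteq> carrier ?K" for J
  proof
    fix p assume p: "p \<in> J"
    have Jc: "J \<subseteq> carrier ?K" using J by (simp add: mv_ideal_def)
    show "p \<in> ?R"
    proof (rule ccontr)
      assume "p \<notin> ?R"
      with p Jc have p1: "fst p \<ge> 1" by (auto simp: carrier_Komori)
      have it: "\<exists>q\<in>J. q = (int m, 0) \<or> fst q \<ge> int n + 1" for n
      proof (induction n)
        case 0 then show ?case using p p1 by auto
      next
        case (Suc n)
        then obtain q where q: "q \<in> J" "q = (int m, 0) \<or> fst q \<ge> int n + 1" by blast
        have "q \<oplus>\<^bsub>?K\<^esub> p \<in> J" using J q p by (simp add: mv_ideal_def)
        moreover have "q \<oplus>\<^bsub>?K\<^esub> p = (int m, 0) \<or> fst (q \<oplus>\<^bsub>?K\<^esub> p) \<ge> int (Suc n) + 1"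
          using q(2) p1 by (auto simp: plus_Komori min_def less_eq_prod_def)
        ultimately show ?case by blast
      qed
      from it[of m] obtain q where "q \<in> J" "q = (int m, 0) \<or> fst q \<ge> int m + 1" by blast
      with Jc have "(int m, 0) \<in> J" by (force simp: carrier_Komori)
      moreover have "mv_le ?K x (int m, 0)" if "x \<in> carrier ?K" for x
        using le[OF that top(1)] that by (auto simp: carrier_Komori less_eq_prod_def)
      ultimately have "carrier ?K \<subseteq> J" using J unfolding mv_ideal_def by blast
      with Jc ne show False by blast
    qed
  qed
  show ?thesis
  proof (intro equalityI subsetI)
    fix M assume "M \<in> mv_Max ?K"
    then have M: "mv_ideal ?K M" "M \<noteq> carrier ?K" and
      mx: "\<And>J. mv_ideal ?K J \<Longrightarrow> J \<noteq> carrier ?K \<Longrightarrow> M \<subseteq> J \<Longrightarrow> J = M"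
      by (auto simp: mv_Max_def)
    have "?R = M" using top by (intro mx R sub M) blast
    then show "M \<in> {?R}" by blast
  next
    fix M assume "M \<in> {?R}"
    moreover have "?R \<noteq> carrier ?K" using top by blast
    ultimately show "M \<in> mv_Max ?K"
      unfolding mv_Max_def using R sub by blast
  qed
qed

lemma has_rank_Komori:
  assumes m: "m > 0"
  shows "has_rank (Komori m) m"
proof -
  let ?K = "Komori m" and ?R = "{p :: int \<times> int. fst p = 0 \<and> 0 \<le> snd p}"
  define cls where "cls a = {p \<in> carrier ?K. fst p = a}" for a
  have Rad: "mv_Rad ?K = ?R"
    using m by (auto simp: mv_Rad_def mv_Max_Komori carrier_Komori)
  have minus: "mv_minus ?K p q = max (p - q) 0" for p q
    by (cases p; cases q) (auto simp: mv_minus_def plus_Komori neg_Komori min_def max_def zero_prod_def)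
  have mem: "mv_minus ?K p q \<oplus>\<^bsub>?K\<^esub> mv_minus ?K q p \<in> ?R \<longleftrightarrow> fst p = fst q" for p q
  proof -
    obtain a b c d where [simp]: "p = (a, b)" "q = (c, d)" by (cases p; cases q) auto
    have m': "\<not> int m \<le> 0" using m by simp
    consider "a < c" | "a = c" | "c < a" by linarith
    then show ?thesis
      using m' by cases (auto simp: minus plus_Komori min_def max_def zero_prod_def)
  qed
  have cong: "ideal_cong ?K ?R =
      {(p, q). p \<in> carrier ?K \<and> q \<in> carrier ?K \<and> fst p = fst q}"
    unfolding ideal_cong_def mem ..
  have img: "ideal_cong ?K ?R `` {p} = cls (fst p)" if "p \<in> carrier ?K" for p
    using that by (auto simp: cong cls_def)
  have "a \<in> fst ` carrier ?K" if "a \<in> {0..int m}" for a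
    using that by (intro image_eqI[of _ _ "(a, 0)"]) (auto simp: carrier_Komori)
  then have fsts: "fst ` carrier ?K = {0..int m}"
    by (auto simp: carrier_Komori)
  have "radical_classes ?K = (\<lambda>p. ideal_cong ?K ?R `` {p}) ` carrier ?K"
    by (auto simp: radical_classes_def mv_ideal_quot_def mv_quot_def Rad quotient_def)
  also have "\<dots> = cls ` fst ` carrier ?K"
    unfolding image_image using img by (rule image_cong[OF HOL.refl])
  finally have rc: "radical_classes ?K = cls ` {0..int m}" by (simp add: fsts)
  have "inj_on cls {0..int m}"
  proof (rule inj_onI)
    fix a b assume ab: "a \<in> {0..int m}" "b \<in> {0..int m}" "cls a = cls b"
    from ab(1) have "(a, 0) \<in> cls a" by (simp add: cls_def carrier_Komori)
    then have "(a, 0) \<in> cls b" using ab(3) by simp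
    then show "a = b" by (simp add: cls_def)
  qed
  then show ?thesis by (simp add: has_rank_def rc card_image)
qed

end

theory Submission
  imports Defs Complex_Main "HOL-Algebra.Group"
begin

text \<open>
The three conditions on ranks are equivalent because a prime ideal \<open>P\<close> lies below exactly one maximal
ideal \<open>M\<close>: the ideals above a prime ideal form a chain. So the radical of \<open>A / P\<close> comes from \<open>M\<close>, the
radical classes of \<open>A / P\<close> are the elements of \<open>A / M\<close>, and \<open>P\<close> and \<open>M\<close> have the same rank
(\<open>ideal_has_rank_iff\<close>). Passing from the free algebra to its quotient by \<open>I\<close> does not change the quotients
by the ideals above \<open>I\<close> (\<open>quotient_preimage_bij\<close>).

If \<open>A\<close> is in the variety of \<open>K\<^sub>m\<close> and \<open>M\<close> is maximal, then \<open>A / M\<close> is a simple chain in this variety. Up to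
infinitesimals \<open>K\<^sub>m\<close> has only \<open>m + 1\<close> elements, and an identity that says so bounds the size of a simple
chain, where nonzero infinitesimals do not exist (\<open>simple_chain_card_le\<close>). A chain of \<open>n + 1\<close> elements is the
Lukasiewicz chain, which contains the fraction \<open>1 / n\<close>; a second identity excludes such an element when
\<open>n\<close> does not divide \<open>m\<close> (\<open>finite_chain_rank_dvd\<close>).

Conversely, \<open>A\<close> is a subdirect product of chains \<open>C = A / P\<close>, so let \<open>C\<close> have rank \<open>n\<close>, where \<open>n\<close> divides \<open>m\<close>, and let
an identity fail in \<open>C\<close> for some values of its variables. \<open>C\<close> is the unit interval of a totally ordered
abelian group, its Chang group. There every subterm of the identity takes the value of an integer linear
form in the variables and the unit, and the signs of finitely many linear forms determine which form it
is. Hence the identity also fails in \<open>K\<^sub>m\<close> as soon as the variables have values there that give these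
finitely many forms the same signs. The first components of such values are dictated by the radical
classes of the old values. What remains for the second components is a finite
system of sign conditions on integers that has a solution in some totally ordered abelian group; by
Fourier-Motzkin elimination it then has a solution in the integers (\<open>integer_point\<close>,
\<open>lexicographic_point\<close>, \<open>satisfies_if_Komori_satisfies\<close>).
\<close>

section \<open>Integer points of total preorders\<close>

text \<open>The signs of the integer linear forms at a tuple of elements of a totally ordered abelian group, seen
without the group: \<open>N c\<close> stands for \<open>\<Sum>i. c i \<cdot> g\<^sub>i \<ge> 0\<close>.\<close>

locale vector_preorder =
  fixes N :: "(nat \<Rightarrow> int) \<Rightarrow> bool"
  assumes total: "N c \<or> N (\<lambda>i. - c i)"
    and add: "N c \<Longrightarrow> N d \<Longrightarrow> N (\<lambda>i. c i + d i)"
begin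

lemma zero: "N (\<lambda>_. 0)"
  using total[of "\<lambda>_. 0"] by simp

lemma scale_nat: "N c \<Longrightarrow> N (\<lambda>i. int a * c i)"
proof (induction a)
  case (Suc a)
  then show ?case using add[of c "\<lambda>i. int a * c i"] by (simp add: algebra_simps)
qed (simp add: zero)

lemma scale: "N c \<Longrightarrow> a \<ge> 0 \<Longrightarrow> N (\<lambda>i. a * c i)"
  using scale_nat[of c "nat a"] by simp

text \<open>If \<open>a c\<close> is nonnegative but \<open>c\<close> is not, then \<open>- c\<close> is, and adding \<open>a - 1\<close> copies of it to \<open>a c\<close> gives \<open>c\<close>.\<close>

lemma scale_iff:
  assumes "a > 0" shows "N (\<lambda>i. a * c i) \<longleftrightarrow> N c"
proof
  assume ac: "N (\<lambda>i. a * c i)"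
  show "N c"
  proof (rule ccontr)
    assume "\<not> N c"
    then have "N (\<lambda>i. (a - 1) * - c i)" using total[of c] assms by (intro scale) auto
    from add[OF ac this] have "N c" by (simp add: algebra_simps)
    with \<open>\<not> N c\<close> show False ..
  qed
qed (use assms scale in simp)

lemma add_null_iff:
  assumes "N e" "N (\<lambda>i. - e i)" shows "N (\<lambda>i. c i + t * e i) \<longleftrightarrow> N c"
proof -
  have te: "N (\<lambda>i. t * e i)" for t
    using scale[OF assms(1), of t] scale[OF assms(2), of "- t"] by (cases "t \<ge> 0") auto
  show ?thesis
    using add[of c "\<lambda>i. t * e i"] add[of "\<lambda>i. c i + t * e i" "\<lambda>i. (- t) * e i"] te[of t] te[of "- t"]
    by auto
qed

lemma strict_add:
  assumes c: "\<not> N (\<lambda>i. - c i)" and d: "\<not> N (\<lambda>i. - d i)"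
  shows "\<not> N (\<lambda>i. - (c i + d i))"
proof
  assume "N (\<lambda>i. - (c i + d i))"
  moreover have "N d" using total[of d] d by auto
  ultimately have "N (\<lambda>i. - (c i + d i) + d i)" by (rule add)
  with c show False by simp
qed

lemma strict_scale:
  assumes "\<not> N (\<lambda>i. - c i)" "a > 0" shows "\<not> N (\<lambda>i. - (a * c i))"
  using scale_iff[of a "\<lambda>i. - c i"] assms by simp

definition dot :: "nat \<Rightarrow> (nat \<Rightarrow> int) \<Rightarrow> (nat \<Rightarrow> rat) \<Rightarrow> rat" where
  "dot k c y = (\<Sum>i<k. of_int (c i) * y i)"

lemma dot_Suc: "dot (Suc k) c (y(k := q)) = dot k c y + of_int (c k) * q"
  by (simp add: dot_def)

lemma dot_comb: "dot k (\<lambda>i. a * c i - b * d i) y = of_int a * dot k c y - of_int b * dot k d y"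
  by (simp add: dot_def sum_subtractf sum_distrib_left algebra_simps)

lemma dot_minus: "dot k (\<lambda>i. - c i) y = - dot k c y"
  by (simp add: dot_def sum_negf)

lemma rat_between:
  fixes U W :: "rat set"
  assumes "finite U" "finite W" "\<And>a b. a \<in> U \<Longrightarrow> b \<in> W \<Longrightarrow> a < b"
  shows "\<exists>q. (\<forall>a\<in>U. a < q) \<and> (\<forall>b\<in>W. q < b)"
proof -
  consider "U = {}" "W = {}" | "U = {}" "W \<noteq> {}" | "U \<noteq> {}" "W = {}" | "U \<noteq> {}" "W \<noteq> {}" by blast
  then show ?thesis
  proof cases
    case 2
    have "Min W - 1 < b" if "b \<in> W" for b using Min_le[OF assms(2) that] by linarith
    then show ?thesis using 2 by blast
  next
    case 3
    have "a < Max U + 1" if "a \<in> U" for a using Max_ge[OF assms(1) that] by linarith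
    then show ?thesis using 3 by blast
  next
    case 4
    then obtain q where "Max U < q" "q < Min W" using assms dense[of "Max U" "Min W"] by auto
    then show ?thesis using assms 4 by auto
  qed simp
qed

text \<open>Fourier-Motzkin elimination of the last coordinate. A form that is zero in the preorder and involves
this coordinate can be solved for it and substituted into all others. If there is no such form, then every
form that involves the coordinate gives a strict lower or a strict upper bound for it, and the
preorder implies that the lower bounds are below the upper ones. Closure of \<open>L\<close> under negation lets the
single equivalence speak about strict signs as well.\<close>

lemma rational_point:
  assumes "finite L" "\<And>c i. c \<in> L \<Longrightarrow> i \<ge> k \<Longrightarrow> c i = 0" "\<And>c. c \<in> L \<Longrightarrow> (\<lambda>i. - c i) \<in> L"
  shows "\<exists>y. \<forall>c\<in>L. N c \<longleftrightarrow> 0 \<le> dot k c y"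
  using assms
proof (induction k arbitrary: L)
  case 0
  have "N c" if "c \<in> L" for c
  proof -
    have "c = (\<lambda>_. 0)" using that 0 by auto
    then show ?thesis using zero by simp
  qed
  then show ?case by (simp add: dot_def)
next
  case (Suc k)
  note fin = Suc.prems(1) and supp = Suc.prems(2) and neg = Suc.prems(3)
  show ?case
  proof (cases "\<exists>e\<in>L. N e \<and> N (\<lambda>i. - e i) \<and> e k \<noteq> 0")
    case True
    then obtain e where e: "e \<in> L" "N e" "N (\<lambda>i. - e i)" "e k > 0"
    proof -
      obtain d where d: "d \<in> L" "N d" "N (\<lambda>i. - d i)" "d k \<noteq> 0" using True by blast
      show ?thesis
      proof (cases "d k > 0")
        case False
        then show ?thesis using d neg[OF d(1)] by (intro that[of "\<lambda>i. - d i"]) auto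
      qed (use d that in blast)
    qed
    \<comment> \<open>The form \<open>c\<close> with coordinate \<open>k\<close> eliminated by means of \<open>e = 0\<close>, up to the factor \<open>e k > 0\<close>.\<close>
    define red where "red c = (\<lambda>i. e k * c i - c k * e i)" for c :: "nat \<Rightarrow> int"
    have "\<exists>y. \<forall>c\<in>red ` L. N c \<longleftrightarrow> 0 \<le> dot k c y"
    proof (rule Suc.IH)
      show "c i = 0" if "c \<in> red ` L" "i \<ge> k" for c i
      proof (cases "i = k")
        case False
        obtain d where d: "d \<in> L" "c = red d" using \<open>c \<in> red ` L\<close> by blast
        have "d i = 0" "e i = 0" using False \<open>i \<ge> k\<close> supp[OF d(1), of i] supp[OF e(1), of i] by auto
        then show ?thesis by (simp add: d red_def)
      qed (use that in \<open>auto simp: red_def\<close>)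
      show "(\<lambda>i. - c i) \<in> red ` L" if "c \<in> red ` L" for c
      proof -
        obtain d where d: "d \<in> L" "c = red d" using \<open>c \<in> red ` L\<close> by blast
        then have "(\<lambda>i. - c i) = red (\<lambda>i. - d i)" by (auto simp: red_def)
        then show ?thesis using neg[OF d(1)] by blast
      qed
    qed (use fin in simp)
    then obtain y where y: "\<And>c. c \<in> L \<Longrightarrow> N (red c) \<longleftrightarrow> 0 \<le> dot k (red c) y" by blast
    define q where "q = - dot k e y / of_int (e k)"
    have "N c \<longleftrightarrow> 0 \<le> dot (Suc k) c (y(k := q))" if c: "c \<in> L" for c
    proof -
      have "N c \<longleftrightarrow> N (\<lambda>i. e k * c i + (- c k) * e i)"
        using e by (simp only: add_null_iff[OF e(2,3)] scale_iff)
      also have "\<dots> \<longleftrightarrow> 0 \<le> dot k (red c) y" using y[OF c] by (simp add: red_def)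
      also have "dot k (red c) y = of_int (e k) * dot (Suc k) c (y(k := q))"
        unfolding red_def dot_comb dot_Suc q_def using e(4) by (simp add: field_simps)
      finally show ?thesis using e(4) by (simp add: zero_le_mult_iff)
    qed
    then show ?thesis by blast
  next
    case False
    define L0 where "L0 = {c \<in> L. c k = 0}"
    define U where "U = {c \<in> L. N c \<and> c k > 0}"
    define W where "W = {c \<in> L. N c \<and> c k < 0}"
    \<comment> \<open>Positivity of \<open>comb c d\<close> says that the lower bound from \<open>c\<close> is below the upper bound from \<open>d\<close>.\<close>
    define comb where "comb c d = (\<lambda>i. c k * d i - d k * c i)" for c d :: "nat \<Rightarrow> int"
    define C where "C = (\<lambda>(c, d). comb c d) ` (U \<times> W) \<union> (\<lambda>(c, d) i. - comb c d i) ` (U \<times> W)"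
    have UW: "\<not> N (\<lambda>i. - c i)" "c \<in> L" if "c \<in> U \<union> W" for c
      using that False by (auto simp: U_def W_def)
    have "\<exists>y. \<forall>c\<in>L0 \<union> C. N c \<longleftrightarrow> 0 \<le> dot k c y"
    proof (rule Suc.IH)
      have "finite U" "finite W" using fin by (auto simp: U_def W_def)
      then show "finite (L0 \<union> C)" using fin by (auto simp: L0_def C_def)
      show "c i = 0" if "c \<in> L0 \<union> C" "i \<ge> k" for c i
      proof -
        have "a i = 0 \<and> b i = 0 \<or> i = k" if "a \<in> U" "b \<in> W" for a b
          using supp[of a i] supp[of b i] UW(2)[of a] UW(2)[of b] that \<open>i \<ge> k\<close> by auto
        moreover have "c i = 0" if "c \<in> L0"
          using supp[of c i] that \<open>i \<ge> k\<close> by (cases "i = k") (auto simp: L0_def)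
        ultimately show ?thesis using \<open>c \<in> L0 \<union> C\<close> by (fastforce simp: C_def comb_def)
      qed
      show "(\<lambda>i. - c i) \<in> L0 \<union> C" if c: "c \<in> L0 \<union> C" for c
      proof (cases "c \<in> L0")
        case True
        then show ?thesis using neg by (auto simp: L0_def)
      next
        case False
        with c obtain a b where "(a, b) \<in> U \<times> W" "c = comb a b \<or> c = (\<lambda>i. - comb a b i)"
          by (auto simp: C_def)
        then show ?thesis by (force simp: C_def)
      qed
    qed
    then obtain y where y: "\<And>c. c \<in> L0 \<union> C \<Longrightarrow> N c \<longleftrightarrow> 0 \<le> dot k c y" by blast
    \<comment> \<open>The value of coordinate \<open>k\<close> at which the form \<open>c\<close> vanishes.\<close>
    define bound where "bound c = - dot k c y / of_int (c k)" for c
    have "bound c < bound d" if cd: "c \<in> U" "d \<in> W" for c d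
    proof -
      have k: "c k > 0" "d k < 0" using cd by (auto simp: U_def W_def)
      have "\<not> N (\<lambda>i. - (c k * d i + (- d k) * c i))"
        using k cd UW[of c] UW[of d] by (intro strict_add strict_scale) auto
      then have "\<not> N (\<lambda>i. - comb c d i)" by (simp add: comb_def)
      moreover have "(\<lambda>i. - comb c d i) \<in> L0 \<union> C" using cd by (force simp: C_def)
      ultimately have "dot k (comb c d) y > 0" using y by (fastforce simp: dot_minus)
      then have "of_int (c k) * dot k d y - of_int (d k) * dot k c y > 0"
        by (simp add: comb_def dot_comb)
      then show ?thesis using k by (simp add: bound_def field_simps)
    qed
    then have "\<exists>q. (\<forall>a\<in>bound ` U. a < q) \<and> (\<forall>b\<in>bound ` W. q < b)"
      using fin by (intro rat_between) (auto simp: U_def W_def)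
    then obtain q where q: "\<And>c. c \<in> U \<Longrightarrow> bound c < q" "\<And>d. d \<in> W \<Longrightarrow> q < bound d"
      by auto
    have pos: "0 < dot (Suc k) c (y(k := q))" if c: "c \<in> L" "N c" "c k \<noteq> 0" for c
    proof (cases "c k > 0")
      case True
      then have "bound c < q" using c by (intro q) (simp add: U_def)
      then show ?thesis using True by (simp add: dot_Suc bound_def field_simps)
    next
      case neg_k: False
      then have "q < bound c" using c by (intro q) (simp add: W_def)
      then show ?thesis using neg_k c by (simp add: dot_Suc bound_def field_simps)
    qed
    have "N c \<longleftrightarrow> 0 \<le> dot (Suc k) c (y(k := q))" if c: "c \<in> L" for c
    proof (cases "c k = 0")
      case True
      then show ?thesis using y[of c] c by (simp add: dot_Suc L0_def)
    next
      case k: False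
      show ?thesis
      proof (cases "N c")
        case True
        then show ?thesis using pos[OF c] k by simp
      next
        case False
        then have "0 < dot (Suc k) (\<lambda>i. - c i) (y(k := q))"
          using neg[OF c] total[of c] k by (intro pos) auto
        then show ?thesis using False by (simp add: dot_minus)
      qed
    qed
    then show ?thesis by blast
  qed
qed

lemma common_denominator:
  fixes y :: "nat \<Rightarrow> rat"
  shows "\<exists>b>0. \<exists>z. \<forall>i<k. of_int b * y i = of_int (z i)"
proof (induction k)
  case (Suc k)
  then obtain b z where b: "b > 0" "\<And>i. i < k \<Longrightarrow> of_int b * y i = of_int (z i)" by blast
  obtain p r where pr: "y k = of_int p / of_int r" "r > 0"
    by (metis quotient_of_denom_pos quotient_of_div surj_pair)
  have "of_int (b * r) * y i = of_int ((z(k := p * b)) i * (if i = k then 1 else r))"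
    if "i < Suc k" for i
    using that b pr by (cases "i = k") (auto simp: field_simps less_Suc_eq)
  then show ?case using b pr
    by (intro exI[of _ "b * r"] conjI exI[of _ "\<lambda>i. (z(k := p * b)) i * (if i = k then 1 else r)"]) auto
qed (auto intro: exI[of _ 1])

text \<open>Finitely many linear forms can be given, at integers, the signs that they have at elements of an
arbitrary totally ordered abelian group.\<close>

lemma integer_point:
  assumes L: "finite L" and supp: "\<And>c i. c \<in> L \<Longrightarrow> i \<ge> k \<Longrightarrow> c i = 0"
  shows "\<exists>y. \<forall>c\<in>L. N c \<longleftrightarrow> 0 \<le> (\<Sum>i<k. c i * y i)"
proof -
  have "\<exists>y. \<forall>c\<in>L \<union> (\<lambda>c i. - c i) ` L. N c \<longleftrightarrow> 0 \<le> dot k c y"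
    by (rule rational_point) (use L supp in auto)
  then obtain y where y: "\<And>c. c \<in> L \<Longrightarrow> N c \<longleftrightarrow> 0 \<le> dot k c y" by blast
  obtain b z where b: "b > 0" and z: "\<And>i. i < k \<Longrightarrow> of_int b * y i = of_int (z i)"
    using common_denominator[where y = y and k = k] by blast
  have "of_int b * dot k c y = of_int (\<Sum>i<k. c i * z i)" for c
    unfolding dot_def sum_distrib_left of_int_sum using z
    by (intro sum.cong HOL.refl) (simp add: ac_simps)
  then have "0 \<le> dot k c y \<longleftrightarrow> 0 \<le> (\<Sum>i<k. c i * z i)" for c
    using b by (metis of_int_0_le_iff of_int_0_less_iff zero_le_mult_iff not_le order.asym)
  then show ?thesis using y by blast
qed

end

section \<open>Arithmetic of MV-algebras\<close>

context mv_algebra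
begin

abbreviation neg :: "'a \<Rightarrow> 'a" ("\<sim> _" [81] 80) where "\<sim>x \<equiv> mv_neg A x"
abbreviation top_elem :: 'a ("\<^bold>1") where "\<^bold>1 \<equiv> \<sim>\<zero>"
abbreviation minus (infixl "\<ominus>" 65) where "x \<ominus> y \<equiv> mv_minus A x y"
abbreviation times (infixl "\<odot>" 70) where "x \<odot> y \<equiv> \<sim>(\<sim>x \<oplus> \<sim>y)"
abbreviation le (infix "\<preceq>" 50) where "x \<preceq> y \<equiv> mv_le A x y"

declare plus_closed [simp] zero_closed [simp] neg_closed [simp] neg_neg [simp]
  plus_zero [simp] plus_neg_zero [simp]

lemma minus_closed [simp]: "x \<in> carrier A \<Longrightarrow> y \<in> carrier A \<Longrightarrow> x \<ominus> y \<in> carrier A"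
  by (simp add: mv_minus_def)

lemma sup_closed [simp]: "x \<in> carrier A \<Longrightarrow> y \<in> carrier A \<Longrightarrow> mv_sup A x y \<in> carrier A"
  by (simp add: mv_sup_def)

lemma inf_closed [simp]: "x \<in> carrier A \<Longrightarrow> y \<in> carrier A \<Longrightarrow> mv_inf A x y \<in> carrier A"
  by (simp add: mv_inf_def)

lemma zero_plus [simp]: "x \<in> carrier A \<Longrightarrow> \<zero> \<oplus> x = x"
  by (simp add: plus_comm[of \<zero>])

lemma one_plus [simp]: "x \<in> carrier A \<Longrightarrow> \<^bold>1 \<oplus> x = \<^bold>1"
  by (simp add: plus_comm[of "\<^bold>1"])

lemma plus_left_comm:
  "x \<in> carrier A \<Longrightarrow> y \<in> carrier A \<Longrightarrow> z \<in> carrier A \<Longrightarrow> x \<oplus> (y \<oplus> z) = y \<oplus> (x \<oplus> z)"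
  by (metis plus_assoc plus_comm)

lemmas plus_ac = plus_assoc plus_comm plus_left_comm

lemma neg_eq_iff: "x \<in> carrier A \<Longrightarrow> y \<in> carrier A \<Longrightarrow> \<sim>x = \<sim>y \<longleftrightarrow> x = y"
  by (metis neg_neg)

lemma neg_plus_self [simp]: "x \<in> carrier A \<Longrightarrow> \<sim>x \<oplus> x = \<^bold>1"
  using sup_comm[of x "\<^bold>1"] by (simp add: mv_sup_def)

lemma plus_neg_self [simp]: "x \<in> carrier A \<Longrightarrow> x \<oplus> \<sim>x = \<^bold>1"
  by (simp add: plus_comm[of x])

text \<open>The order in terms of \<open>\<oplus>\<close> alone; in this form residuation is associativity.\<close>

lemma le_iff:
  assumes "x \<in> carrier A" "y \<in> carrier A" shows "x \<preceq> y \<longleftrightarrow> \<sim>x \<oplus> y = \<^bold>1"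
proof
  assume "x \<preceq> y"
  then have "\<sim>x \<oplus> y = \<sim>x \<oplus> (\<sim>(\<sim>x \<oplus> y) \<oplus> y)" by (simp add: mv_le_def mv_sup_def)
  also have "\<dots> = \<sim>(\<sim>x \<oplus> y) \<oplus> (\<sim>x \<oplus> y)" using assms by (simp add: plus_left_comm)
  finally show "\<sim>x \<oplus> y = \<^bold>1" using assms by simp
qed (use assms in \<open>simp add: mv_le_def mv_sup_def\<close>)

lemma minus_le_iff:
  "x \<in> carrier A \<Longrightarrow> y \<in> carrier A \<Longrightarrow> z \<in> carrier A \<Longrightarrow> x \<ominus> y \<preceq> z \<longleftrightarrow> x \<preceq> y \<oplus> z"
  by (simp add: le_iff mv_minus_def plus_assoc)

lemma sup_eq: "mv_sup A x y = (x \<ominus> y) \<oplus> y"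
  by (simp add: mv_sup_def mv_minus_def)

lemma minus_plus_of_le:
  "x \<in> carrier A \<Longrightarrow> y \<in> carrier A \<Longrightarrow> x \<preceq> y \<Longrightarrow> (y \<ominus> x) \<oplus> x = y"
  using sup_comm[of x y] by (simp add: mv_le_def sup_eq)

lemma le_plus [simp]: "x \<in> carrier A \<Longrightarrow> y \<in> carrier A \<Longrightarrow> x \<preceq> x \<oplus> y"
  by (simp add: le_iff plus_assoc[symmetric])

lemma le_plus2 [simp]: "x \<in> carrier A \<Longrightarrow> y \<in> carrier A \<Longrightarrow> x \<preceq> y \<oplus> x"
  by (simp add: plus_comm[of y])

lemma le_refl [simp]: "x \<in> carrier A \<Longrightarrow> x \<preceq> x"
  by (simp add: le_iff)

lemma zero_le [simp]: "x \<in> carrier A \<Longrightarrow> \<zero> \<preceq> x"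
  by (simp add: le_iff)

lemma le_one [simp]: "x \<in> carrier A \<Longrightarrow> x \<preceq> \<^bold>1"
  by (simp add: le_iff)

lemma le_trans:
  assumes "x \<in> carrier A" "y \<in> carrier A" "z \<in> carrier A" "x \<preceq> y" "y \<preceq> z" shows "x \<preceq> z"
proof -
  have "z = x \<oplus> ((y \<ominus> x) \<oplus> (z \<ominus> y))"
    using assms minus_plus_of_le[of x y] minus_plus_of_le[of y z]
    by (metis minus_closed plus_assoc plus_comm plus_closed)
  then show ?thesis using assms by (metis le_plus minus_closed plus_closed)
qed

lemma le_antisym:
  "x \<in> carrier A \<Longrightarrow> y \<in> carrier A \<Longrightarrow> x \<preceq> y \<Longrightarrow> y \<preceq> x \<Longrightarrow> x = y"
  using sup_comm[of x y] by (simp add: mv_le_def)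

lemma le_zero_iff [simp]: "x \<in> carrier A \<Longrightarrow> x \<preceq> \<zero> \<longleftrightarrow> x = \<zero>"
  using le_antisym[of x \<zero>] by auto

lemma one_le_iff [simp]: "x \<in> carrier A \<Longrightarrow> \<^bold>1 \<preceq> x \<longleftrightarrow> x = \<^bold>1"
  using le_antisym[of x "\<^bold>1"] by auto

lemma plus_zero_iff: "x \<in> carrier A \<Longrightarrow> y \<in> carrier A \<Longrightarrow> x \<oplus> y = \<zero> \<longleftrightarrow> x = \<zero> \<and> y = \<zero>"
  by (metis le_plus le_plus2 le_zero_iff plus_zero zero_closed)

lemma neg_le_neg_iff [simp]:
  "x \<in> carrier A \<Longrightarrow> y \<in> carrier A \<Longrightarrow> \<sim>x \<preceq> \<sim>y \<longleftrightarrow> y \<preceq> x"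
  by (simp add: le_iff plus_comm)

lemma neg_le_iff:
  "x \<in> carrier A \<Longrightarrow> y \<in> carrier A \<Longrightarrow> \<sim>x \<preceq> y \<longleftrightarrow> x \<oplus> y = \<^bold>1"
  by (simp add: le_iff)

lemma plus_mono_right:
  assumes "x \<in> carrier A" "y \<in> carrier A" "z \<in> carrier A" "x \<preceq> y" shows "z \<oplus> x \<preceq> z \<oplus> y"
proof -
  have "z \<oplus> y = (z \<oplus> x) \<oplus> (y \<ominus> x)"
    using assms minus_plus_of_le[of x y] by (metis minus_closed plus_assoc plus_comm)
  then show ?thesis using assms by simp
qed

lemma plus_mono:
  assumes "x \<in> carrier A" "y \<in> carrier A" "z \<in> carrier A" "w \<in> carrier A" "x \<preceq> y" "z \<preceq> w"
  shows "x \<oplus> z \<preceq> y \<oplus> w"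
  using assms plus_mono_right[of z w x] plus_mono_right[of x y w]
  by (metis le_trans plus_closed plus_comm)

lemma minus_le [simp]: "x \<in> carrier A \<Longrightarrow> y \<in> carrier A \<Longrightarrow> x \<ominus> y \<preceq> x"
  by (simp add: minus_le_iff)

lemma minus_zero_iff:
  "x \<in> carrier A \<Longrightarrow> y \<in> carrier A \<Longrightarrow> x \<ominus> y = \<zero> \<longleftrightarrow> x \<preceq> y"
  using minus_le_iff[of x y \<zero>] by simp

lemma minus_self [simp]: "x \<in> carrier A \<Longrightarrow> x \<ominus> x = \<zero>"
  by (simp add: minus_zero_iff)

lemma minus_zero [simp]: "x \<in> carrier A \<Longrightarrow> x \<ominus> \<zero> = x"
  by (simp add: mv_minus_def)

lemma zero_minus [simp]: "x \<in> carrier A \<Longrightarrow> \<zero> \<ominus> x = \<zero>"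
  by (simp add: minus_zero_iff)

lemma neg_minus_neg: "x \<in> carrier A \<Longrightarrow> y \<in> carrier A \<Longrightarrow> \<sim>x \<ominus> \<sim>y = y \<ominus> x"
  by (simp add: mv_minus_def plus_comm)

lemma minus_plus_eq:
  "x \<in> carrier A \<Longrightarrow> y \<in> carrier A \<Longrightarrow> z \<in> carrier A \<Longrightarrow> x \<ominus> (y \<oplus> z) = (x \<ominus> y) \<ominus> z"
  by (simp add: mv_minus_def plus_assoc)

lemma inf_eq: "x \<in> carrier A \<Longrightarrow> y \<in> carrier A \<Longrightarrow> mv_inf A x y = x \<ominus> (x \<ominus> y)"
  using sup_comm[of "\<sim>x" "\<sim>y"]
  by (simp add: mv_inf_def mv_sup_def mv_minus_def plus_comm)

lemma inf_comm: "x \<in> carrier A \<Longrightarrow> y \<in> carrier A \<Longrightarrow> mv_inf A x y = mv_inf A y x"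
  using sup_comm[of "\<sim>x" "\<sim>y"] by (simp add: mv_inf_def)

lemma inf_le1 [simp]: "x \<in> carrier A \<Longrightarrow> y \<in> carrier A \<Longrightarrow> mv_inf A x y \<preceq> x"
  by (simp add: inf_eq)

lemma inf_le2 [simp]: "x \<in> carrier A \<Longrightarrow> y \<in> carrier A \<Longrightarrow> mv_inf A x y \<preceq> y"
  using inf_comm inf_le1 by metis

lemma minus_mono_left:
  assumes "x \<in> carrier A" "y \<in> carrier A" "z \<in> carrier A" "x \<preceq> y" shows "x \<ominus> z \<preceq> y \<ominus> z"
proof -
  have "y \<preceq> z \<oplus> (y \<ominus> z)" using assms by (simp add: minus_le_iff[symmetric])
  then show ?thesis using assms le_trans[of x y "z \<oplus> (y \<ominus> z)"] by (simp add: minus_le_iff)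
qed

lemma sup_least:
  assumes "x \<in> carrier A" "y \<in> carrier A" "z \<in> carrier A" "x \<preceq> z" "y \<preceq> z"
  shows "mv_sup A x y \<preceq> z"
proof -
  have "(x \<ominus> y) \<oplus> y \<preceq> (z \<ominus> y) \<oplus> y" using assms by (intro plus_mono minus_mono_left) auto
  also have "(z \<ominus> y) \<oplus> y = z" using assms by (simp add: minus_plus_of_le)
  finally show ?thesis by (simp add: sup_eq)
qed

lemma inf_greatest:
  assumes "x \<in> carrier A" "y \<in> carrier A" "z \<in> carrier A" "z \<preceq> x" "z \<preceq> y"
  shows "z \<preceq> mv_inf A x y"
proof -
  have "\<sim>z \<in> carrier A" "mv_sup A (\<sim>x) (\<sim>y) \<preceq> \<sim>z"
    using assms by (auto intro!: sup_least)
  then have "\<sim>(\<sim>z) \<preceq> \<sim>(mv_sup A (\<sim>x) (\<sim>y))"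
    using assms by (subst neg_le_neg_iff) auto
  then show ?thesis using assms by (simp add: mv_inf_def)
qed

lemma plus_minus_eq_inf:
  "x \<in> carrier A \<Longrightarrow> y \<in> carrier A \<Longrightarrow> (x \<oplus> y) \<ominus> y = mv_inf A x (\<sim>y)"
  by (subst inf_comm) (simp_all add: inf_eq mv_minus_def plus_comm)

lemma inf_absorb1: "x \<in> carrier A \<Longrightarrow> y \<in> carrier A \<Longrightarrow> x \<preceq> y \<Longrightarrow> mv_inf A x y = x"
  using minus_zero_iff[of x y] by (simp add: inf_eq)

text \<open>With \<open>p = x \<sqinter> y\<close>, both \<open>x = p \<oplus> (x \<ominus> y)\<close> and \<open>y = p \<oplus> (y \<ominus> x)\<close> are sums without
  truncation, so \<open>p\<close> cancels in \<open>x \<ominus> y\<close>, which leaves \<open>x \<ominus> y = (x \<ominus> y) \<ominus> (y \<ominus> x)\<close>.\<close>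

lemma prelinearity:
  assumes "x \<in> carrier A" "y \<in> carrier A"
  shows "mv_inf A (x \<ominus> y) (y \<ominus> x) = \<zero>"
proof -
  define t w p where "t = x \<ominus> y" and "w = y \<ominus> x" and "p = mv_inf A x y"
  have c [simp]: "t \<in> carrier A" "w \<in> carrier A" "p \<in> carrier A"
    using assms by (auto simp: t_def w_def p_def)
  have pt: "p = x \<ominus> t" and pw: "p = y \<ominus> w"
    using assms inf_comm[of x y] by (auto simp: p_def t_def w_def inf_eq)
  have x: "x = p \<oplus> t" and y: "y = p \<oplus> w"
    using assms minus_plus_of_le[of t x] minus_plus_of_le[of w y] pt pw
    by (auto simp: t_def w_def)
  have "\<sim>p = \<sim>x \<oplus> t" using assms by (simp add: pt mv_minus_def)
  then have tp: "t \<preceq> \<sim>p" using assms by simp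
  have "t = (t \<oplus> p) \<ominus> (p \<oplus> w)" using x y c unfolding t_def by (metis plus_comm)
  also have "\<dots> = ((t \<oplus> p) \<ominus> p) \<ominus> w" by (simp add: minus_plus_eq)
  also have "\<dots> = t \<ominus> w" using tp by (simp add: plus_minus_eq_inf inf_absorb1)
  finally have "t \<ominus> w = t" ..
  then show ?thesis by (simp add: t_def[symmetric] w_def[symmetric] inf_eq)
qed

text \<open>If \<open>w\<close> lies below \<open>x\<close> and below \<open>y \<oplus> z\<close>, then \<open>w \<ominus> y\<close> lies below \<open>x\<close> and \<open>z\<close>, so it is \<open>0\<close>.\<close>

lemma disjoint_plus:
  assumes "x \<in> carrier A" "y \<in> carrier A" "z \<in> carrier A"
    and "mv_inf A x y = \<zero>" "mv_inf A x z = \<zero>"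
  shows "mv_inf A x (y \<oplus> z) = \<zero>"
proof -
  define w where "w = mv_inf A x (y \<oplus> z)"
  have w: "w \<in> carrier A" "w \<preceq> x" "w \<preceq> y \<oplus> z" using assms by (auto simp: w_def)
  then have "w \<ominus> y \<preceq> z" "w \<ominus> y \<preceq> x"
    using assms le_trans[of "w \<ominus> y" w x] by (auto simp: minus_le_iff)
  then have "w \<ominus> y = \<zero>" using assms w inf_greatest[of x z "w \<ominus> y"] by simp
  then have "w \<preceq> y" using w assms by (simp add: minus_zero_iff)
  then show ?thesis using assms w inf_greatest[of x y w] by (simp add: w_def)
qed

primrec multiple :: "nat \<Rightarrow> 'a \<Rightarrow> 'a" where
  "multiple 0 x = \<zero>"
| "multiple (Suc n) x = x \<oplus> multiple n x"

lemma multiple_closed [simp]: "x \<in> carrier A \<Longrightarrow> multiple n x \<in> carrier A"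
  by (induction n) auto

lemma multiple_add: "x \<in> carrier A \<Longrightarrow> multiple (n + k) x = multiple n x \<oplus> multiple k x"
  by (induction n) (auto simp: plus_assoc)

lemma disjoint_multiple_right:
  "x \<in> carrier A \<Longrightarrow> y \<in> carrier A \<Longrightarrow> mv_inf A x y = \<zero> \<Longrightarrow> mv_inf A x (multiple n y) = \<zero>"
  by (induction n) (auto simp: disjoint_plus inf_comm[of x \<zero>] inf_absorb1)

lemma disjoint_multiple:
  assumes "x \<in> carrier A" "y \<in> carrier A" "mv_inf A x y = \<zero>"
  shows "mv_inf A (multiple n x) (multiple k y) = \<zero>"
proof -
  have "mv_inf A (multiple k y) x = \<zero>" using assms disjoint_multiple_right[of x y k] by (simp add: inf_comm)
  then show ?thesis using assms disjoint_multiple_right[of "multiple k y" x n] by (simp add: inf_comm)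
qed

section \<open>Ideals\<close>

lemma ideal_subset: "mv_ideal A J \<Longrightarrow> x \<in> J \<Longrightarrow> x \<in> carrier A"
  unfolding mv_ideal_def by blast

lemma ideal_down: "mv_ideal A J \<Longrightarrow> y \<in> J \<Longrightarrow> x \<in> carrier A \<Longrightarrow> x \<preceq> y \<Longrightarrow> x \<in> J"
  unfolding mv_ideal_def by blast

lemma ideal_plus: "mv_ideal A J \<Longrightarrow> x \<in> J \<Longrightarrow> y \<in> J \<Longrightarrow> x \<oplus> y \<in> J"
  unfolding mv_ideal_def by blast

lemma ideal_zero:
  assumes "mv_ideal A J" shows "\<zero> \<in> J"
proof -
  obtain x where "x \<in> J" using assms unfolding mv_ideal_def by blast
  then show ?thesis using ideal_down[OF assms _ zero_closed] ideal_subset[OF assms] zero_le by blast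
qed

lemma ideal_multiple: "mv_ideal A J \<Longrightarrow> x \<in> J \<Longrightarrow> multiple n x \<in> J"
  by (induction n) (simp_all add: ideal_zero ideal_plus)

lemma ideal_proper_iff: "mv_ideal A J \<Longrightarrow> J \<noteq> carrier A \<longleftrightarrow> \<^bold>1 \<notin> J"
  using ideal_down[of J "\<^bold>1"] ideal_subset[of J] le_one neg_closed[OF zero_closed] by blast

lemma ideal_plus_iff:
  "mv_ideal A J \<Longrightarrow> x \<in> carrier A \<Longrightarrow> y \<in> carrier A \<Longrightarrow> x \<oplus> y \<in> J \<longleftrightarrow> x \<in> J \<and> y \<in> J"
  using ideal_plus[of J x y] ideal_down[of J "x \<oplus> y" x] ideal_down[of J "x \<oplus> y" y]
    le_plus le_plus2 by blast

text \<open>The ideal generated by \<open>J\<close> and \<open>x\<close>.\<close>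

definition extend_ideal :: "'a set \<Rightarrow> 'a \<Rightarrow> 'a set" where
  "extend_ideal J x = {z \<in> carrier A. \<exists>p\<in>J. \<exists>n. z \<preceq> p \<oplus> multiple n x}"

lemma extend_ideal:
  assumes J: "mv_ideal A J" and x: "x \<in> carrier A"
  shows "mv_ideal A (extend_ideal J x)" "J \<subseteq> extend_ideal J x" "x \<in> extend_ideal J x"
proof -
  note Jc [simp] = ideal_subset[OF J]
  show sub: "J \<subseteq> extend_ideal J x"
  proof
    fix p assume p: "p \<in> J"
    then have "p \<preceq> p \<oplus> multiple 0 x" by simp
    then show "p \<in> extend_ideal J x" unfolding extend_ideal_def using p Jc by blast
  qed
  show "x \<in> extend_ideal J x"
  proof -
    have "x \<preceq> \<zero> \<oplus> multiple 1 x" using x by simp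
    then show ?thesis unfolding extend_ideal_def using x ideal_zero[OF J] by blast
  qed
  show "mv_ideal A (extend_ideal J x)"
    unfolding mv_ideal_def
  proof (intro conjI ballI impI)
    show "extend_ideal J x \<noteq> {}" using sub ideal_zero[OF J] by auto
    fix y z assume "y \<in> carrier A" "z \<in> extend_ideal J x" "y \<preceq> z"
    moreover from this obtain p n where "p \<in> J" "z \<preceq> p \<oplus> multiple n x" "z \<in> carrier A"
      by (auto simp: extend_ideal_def)
    moreover from calculation have "y \<preceq> p \<oplus> multiple n x"
      using x le_trans[of y z "p \<oplus> multiple n x"] by simp
    ultimately show "y \<in> extend_ideal J x" unfolding extend_ideal_def by blast
  next
    fix y z assume "y \<in> extend_ideal J x" "z \<in> extend_ideal J x"
    then obtain p n q k where *: "p \<in> J" "q \<in> J" "y \<preceq> p \<oplus> multiple n x" "z \<preceq> q \<oplus> multiple k x"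
      and yz [simp]: "y \<in> carrier A" "z \<in> carrier A"
      by (auto simp: extend_ideal_def)
    then have "y \<oplus> z \<preceq> (p \<oplus> multiple n x) \<oplus> (q \<oplus> multiple k x)" using x by (intro plus_mono) auto
    also have "\<dots> = (p \<oplus> q) \<oplus> multiple (n + k) x" using * x by (simp add: multiple_add plus_ac)
    finally show "y \<oplus> z \<in> extend_ideal J x"
      unfolding extend_ideal_def using ideal_plus[OF J *(1,2)] yz plus_closed by blast
  qed (auto simp: extend_ideal_def)
qed

text \<open>For \<open>a = \<not>0\<close> these are the maximal ideals, and for every \<open>a \<in> A\<close> they are prime. One use of Zorn's lemma
therefore yields both the maximal ideals above a proper ideal and a prime ideal that misses a given
nonzero element.\<close>

definition avoiding :: "'a \<Rightarrow> 'a set \<Rightarrow> bool" where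
  "avoiding a P \<longleftrightarrow> mv_ideal A P \<and> a \<notin> P \<and> (\<forall>J. mv_ideal A J \<and> a \<notin> J \<and> P \<subseteq> J \<longrightarrow> J = P)"

lemma ex_avoiding:
  assumes J: "mv_ideal A J" "a \<notin> J"
  shows "\<exists>P. J \<subseteq> P \<and> avoiding a P"
proof -
  define S where "S = {K. mv_ideal A K \<and> a \<notin> K \<and> J \<subseteq> K}"
  have "\<exists>P\<in>S. \<forall>K\<in>S. P \<subseteq> K \<longrightarrow> K = P"
  proof (rule subset_Zorn_nonempty)
    show "S \<noteq> {}" using J by (auto simp: S_def)
    fix \<C> assume ne: "\<C> \<noteq> {}" and ch: "subset.chain S \<C>"
    have id: "mv_ideal A K" "a \<notin> K" "J \<subseteq> K" if "K \<in> \<C>" for K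
      using ch that unfolding subset.chain_def S_def by blast+
    have tot: "K \<subseteq> K' \<or> K' \<subseteq> K" if "K \<in> \<C>" "K' \<in> \<C>" for K K'
      using ch that unfolding subset.chain_def by blast
    have "mv_ideal A (\<Union>\<C>)"
      unfolding mv_ideal_def
    proof (intro conjI ballI impI)
      show "\<Union>\<C> \<subseteq> carrier A" using id ideal_subset by blast
      show "\<Union>\<C> \<noteq> {}" using ne id ideal_zero by blast
      fix x y assume "x \<in> carrier A" "y \<in> \<Union>\<C>" "x \<preceq> y"
      then show "x \<in> \<Union>\<C>" using id(1) ideal_down by blast
    next
      fix x y assume "x \<in> \<Union>\<C>" "y \<in> \<Union>\<C>"
      then obtain K K' where "K \<in> \<C>" "K' \<in> \<C>" "x \<in> K" "y \<in> K'" by blast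
      then show "x \<oplus> y \<in> \<Union>\<C>" using tot[of K K'] id(1) ideal_plus by blast
    qed
    moreover have "a \<notin> \<Union>\<C>" "J \<subseteq> \<Union>\<C>" using ne id by blast+
    ultimately show "\<Union>\<C> \<in> S" by (simp add: S_def)
  qed
  then obtain P where P: "P \<in> S" "\<And>K. K \<in> S \<Longrightarrow> P \<subseteq> K \<Longrightarrow> K = P" by blast
  then have "avoiding a P" unfolding avoiding_def S_def by blast
  with P(1) show ?thesis by (auto simp: S_def)
qed

lemma not_in_avoiding_iff:
  assumes P: "avoiding a P" and x: "x \<in> carrier A"
  shows "x \<notin> P \<longleftrightarrow> a \<in> extend_ideal P x"
proof
  have id: "mv_ideal A P" and na: "a \<notin> P" using P by (simp_all add: avoiding_def)
  note ext = extend_ideal[OF id x]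
  { assume "x \<notin> P"
    then have "extend_ideal P x \<noteq> P" using ext by blast
    then show "a \<in> extend_ideal P x" using P ext unfolding avoiding_def by blast }
  { assume a: "a \<in> extend_ideal P x"
    show "x \<notin> P"
    proof
      assume "x \<in> P"
      from a obtain p n where *: "p \<in> P" "a \<preceq> p \<oplus> multiple n x" and "a \<in> carrier A"
        by (auto simp: extend_ideal_def)
      then have "a \<in> P"
        using ideal_down[OF id ideal_plus[OF id \<open>p \<in> P\<close> ideal_multiple[OF id \<open>x \<in> P\<close>]]] by blast
      with na show False ..
    qed }
qed

text \<open>If neither difference were in \<open>P\<close>, then \<open>a\<close> would lie
  below \<open>p\<close> plus a multiple of each of two disjoint elements, hence below \<open>p\<close>.\<close>

lemma avoiding_linear:
  assumes P: "avoiding a P" and xy: "x \<in> carrier A" "y \<in> carrier A"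
  shows "x \<ominus> y \<in> P \<or> y \<ominus> x \<in> P"
proof (rule ccontr)
  assume "\<not> ?thesis"
  then have "a \<in> extend_ideal P (x \<ominus> y)" "a \<in> extend_ideal P (y \<ominus> x)"
    using not_in_avoiding_iff[OF P] xy by auto
  then obtain p n q k where *: "p \<in> P" "q \<in> P" "a \<preceq> p \<oplus> multiple n (x \<ominus> y)" "a \<preceq> q \<oplus> multiple k (y \<ominus> x)"
    and a: "a \<in> carrier A" by (auto simp: extend_ideal_def)
  have id: "mv_ideal A P" and na: "a \<notin> P" using P by (simp_all add: avoiding_def)
  have pq [simp]: "p \<in> carrier A" "q \<in> carrier A" using * id ideal_subset by auto
  have "a \<ominus> (p \<oplus> q) \<preceq> multiple n (x \<ominus> y)"
    using * a xy le_trans[OF _ _ _ *(3), of "(p \<oplus> q) \<oplus> multiple n (x \<ominus> y)"]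
      plus_mono[of p "p \<oplus> q" "multiple n (x \<ominus> y)" "multiple n (x \<ominus> y)"]
    by (simp add: minus_le_iff)
  moreover have "a \<ominus> (p \<oplus> q) \<preceq> multiple k (y \<ominus> x)"
    using * a xy le_trans[OF _ _ _ *(4), of "(p \<oplus> q) \<oplus> multiple k (y \<ominus> x)"]
      plus_mono[of q "p \<oplus> q" "multiple k (y \<ominus> x)" "multiple k (y \<ominus> x)"]
    by (simp add: minus_le_iff)
  ultimately have "a \<ominus> (p \<oplus> q) \<preceq> mv_inf A (multiple n (x \<ominus> y)) (multiple k (y \<ominus> x))"
    using a xy by (intro inf_greatest) auto
  then have "a \<preceq> p \<oplus> q"
    using a xy disjoint_multiple[of "x \<ominus> y" "y \<ominus> x"] prelinearity by (simp add: minus_zero_iff)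
  then show False using ideal_down[OF id ideal_plus[OF id *(1,2)] a] na by blast
qed

text \<open>Primality says that the quotient is a chain: one direction is prelinearity, the other uses
\<open>x = (x \<sqinter> y) \<oplus> (x \<ominus> y)\<close>.\<close>

lemma Spec_iff:
  "P \<in> mv_Spec A \<longleftrightarrow> mv_ideal A P \<and> \<^bold>1 \<notin> P \<and>
     (\<forall>x\<in>carrier A. \<forall>y\<in>carrier A. x \<ominus> y \<in> P \<or> y \<ominus> x \<in> P)"
proof (cases "mv_ideal A P")
  case id: True
  have "(\<forall>x\<in>carrier A. \<forall>y\<in>carrier A. mv_inf A x y \<in> P \<longrightarrow> x \<in> P \<or> y \<in> P) \<longleftrightarrow>
    (\<forall>x\<in>carrier A. \<forall>y\<in>carrier A. x \<ominus> y \<in> P \<or> y \<ominus> x \<in> P)" (is "?l \<longleftrightarrow> ?r")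
  proof
    assume ?l
    then show ?r using prelinearity ideal_zero[OF id] by (metis minus_closed)
  next
    assume r: ?r
    have *: "x \<in> P" if "x \<in> carrier A" "y \<in> carrier A" "mv_inf A x y \<in> P" "x \<ominus> y \<in> P" for x y
    proof -
      have "x = mv_inf A x y \<oplus> (x \<ominus> y)"
        using that minus_plus_of_le[of "x \<ominus> y" x] by (simp add: inf_eq)
      then show ?thesis using that ideal_plus[OF id] by metis
    qed
    show ?l using r * inf_comm by metis
  qed
  then show ?thesis by (simp only: mv_Spec_def mem_Collect_eq id ideal_proper_iff[OF id] simp_thms)
qed (simp add: mv_Spec_def)

lemma avoiding_Spec:
  assumes "avoiding a P" "a \<in> carrier A" shows "P \<in> mv_Spec A"
proof -
  have id: "mv_ideal A P" and "a \<notin> P" using assms(1) by (simp_all add: avoiding_def)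
  then have "\<^bold>1 \<notin> P" using ideal_down[OF id _ assms(2) le_one[OF assms(2)]] by blast
  with id avoiding_linear[OF assms(1)] show ?thesis by (simp only: Spec_iff simp_thms) blast
qed

lemma Max_iff: "M \<in> mv_Max A \<longleftrightarrow> avoiding \<^bold>1 M"
  unfolding mv_Max_def avoiding_def mem_Collect_eq using ideal_proper_iff by (safe; blast)

lemma Max_subset_Spec: "mv_Max A \<subseteq> mv_Spec A"
  using Max_iff avoiding_Spec neg_closed zero_closed by blast

lemma ex_Max_above: "P \<in> mv_Spec A \<Longrightarrow> \<exists>M\<in>mv_Max A. P \<subseteq> M"
  using ex_avoiding[of P "\<^bold>1"] Spec_iff Max_iff by blast

text \<open>If \<open>x \<in> M - N\<close> and \<open>y \<in> N - M\<close>, then one of \<open>x \<ominus> y\<close> and \<open>y \<ominus> x\<close> lies in \<open>P\<close>, which puts \<open>x\<close> into \<open>N\<close> or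
  \<open>y\<close> into \<open>M\<close>.\<close>

lemma ideals_above_prime_linear:
  assumes P: "P \<in> mv_Spec A" and M: "mv_ideal A M" "P \<subseteq> M" and N: "mv_ideal A N" "P \<subseteq> N"
  shows "M \<subseteq> N \<or> N \<subseteq> M"
proof (rule ccontr)
  assume "\<not> ?thesis"
  then obtain x y where xy: "x \<in> M" "x \<notin> N" "y \<in> N" "y \<notin> M" by blast
  then have c: "x \<in> carrier A" "y \<in> carrier A" using M N ideal_subset by auto
  have *: "x \<in> K" if "mv_ideal A K" "y \<in> K" "x \<ominus> y \<in> K" "x \<in> carrier A" "y \<in> carrier A" for x y K
  proof -
    have "x \<preceq> y \<oplus> (x \<ominus> y)" using that by (simp add: minus_le_iff[symmetric])
    then show ?thesis using that ideal_down ideal_plus by metis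
  qed
  have "x \<ominus> y \<in> P \<or> y \<ominus> x \<in> P" using P c by (simp add: Spec_iff)
  then show False using c xy *[of N y x] *[of M x y] M N by blast
qed

lemma Max_above_prime_unique:
  assumes "P \<in> mv_Spec A" "M \<in> mv_Max A" "P \<subseteq> M" "N \<in> mv_Max A" "P \<subseteq> N"
  shows "M = N"
  using ideals_above_prime_linear[of P M N] assms unfolding mv_Max_def by blast

lemma Max_archimedean:
  assumes M: "M \<in> mv_Max A" and x: "x \<in> carrier A" "x \<notin> M"
  shows "\<exists>n. \<sim>(multiple n x) \<in> M"
proof -
  have id: "mv_ideal A M" and "\<^bold>1 \<in> extend_ideal M x"
    using M x not_in_avoiding_iff[of "\<^bold>1" M x] by (simp_all add: Max_iff avoiding_def)
  then obtain p n where p: "p \<in> M" "\<^bold>1 \<preceq> p \<oplus> multiple n x" by (auto simp: extend_ideal_def)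
  have "\<sim>(multiple n x) \<preceq> p"
    using p x ideal_subset[OF id p(1)] by (subst neg_le_iff) (auto simp: plus_comm)
  then have "\<sim>(multiple n x) \<in> M" using ideal_down[OF id p(1)] x by simp
  then show ?thesis ..
qed

lemma Rad_ideal: "mv_ideal A (mv_Rad A)"
proof -
  have id: "mv_ideal A M" if "M \<in> mv_Max A" for M using that by (simp add: mv_Max_def)
  show ?thesis unfolding mv_ideal_def
  proof (intro conjI ballI impI)
    have "\<zero> \<in> mv_Rad A" using id ideal_zero by (auto simp: mv_Rad_def)
    then show "mv_Rad A \<noteq> {}" by blast
    show "x \<in> mv_Rad A" if "x \<in> carrier A" "y \<in> mv_Rad A" "x \<preceq> y" for x y
      using that id ideal_down[of _ y x] by (simp add: mv_Rad_def)
    show "x \<oplus> y \<in> mv_Rad A" if "x \<in> mv_Rad A" "y \<in> mv_Rad A" for x y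
      using that id ideal_plus[of _ x y] by (simp add: mv_Rad_def)
  qed (simp add: mv_Rad_def)
qed

section \<open>Congruences\<close>

abbreviation dist :: "'a \<Rightarrow> 'a \<Rightarrow> 'a" where "dist x y \<equiv> (x \<ominus> y) \<oplus> (y \<ominus> x)"

lemma dist_zero_iff: "x \<in> carrier A \<Longrightarrow> y \<in> carrier A \<Longrightarrow> dist x y = \<zero> \<longleftrightarrow> x = y"
  using plus_zero_iff[of "x \<ominus> y" "y \<ominus> x"] le_antisym[of x y] by (auto simp: minus_zero_iff)

lemma ideal_cong_iff:
  assumes "mv_ideal A J"
  shows "(x, y) \<in> ideal_cong A J \<longleftrightarrow> x \<in> carrier A \<and> y \<in> carrier A \<and> x \<ominus> y \<in> J \<and> y \<ominus> x \<in> J"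
  using assms ideal_plus_iff[OF assms, of "x \<ominus> y" "y \<ominus> x"] by (auto simp: ideal_cong_def)

lemma minus_triangle:
  assumes "x \<in> carrier A" "y \<in> carrier A" "z \<in> carrier A"
  shows "x \<ominus> z \<preceq> (x \<ominus> y) \<oplus> (y \<ominus> z)"
proof -
  have "x \<preceq> y \<oplus> (x \<ominus> y)" using assms by (simp add: minus_le_iff[symmetric])
  moreover have "y \<oplus> (x \<ominus> y) \<preceq> (z \<oplus> (y \<ominus> z)) \<oplus> (x \<ominus> y)"
    using assms by (intro plus_mono) (auto simp: minus_le_iff[symmetric])
  ultimately have "x \<preceq> (z \<oplus> (y \<ominus> z)) \<oplus> (x \<ominus> y)"
    using assms le_trans[of x "y \<oplus> (x \<ominus> y)"] by simp
  then show ?thesis using assms by (simp add: minus_le_iff plus_ac)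
qed

lemma minus_plus_plus:
  assumes "x \<in> carrier A" "y \<in> carrier A" "z \<in> carrier A" "w \<in> carrier A"
  shows "(x \<oplus> z) \<ominus> (y \<oplus> w) \<preceq> (x \<ominus> y) \<oplus> (z \<ominus> w)"
proof -
  have "x \<oplus> z \<preceq> (y \<oplus> (x \<ominus> y)) \<oplus> (w \<oplus> (z \<ominus> w))"
    using assms by (intro plus_mono) (auto simp: minus_le_iff[symmetric])
  then show ?thesis using assms by (simp add: minus_le_iff plus_ac)
qed

lemma ideal_cong_equiv:
  assumes J: "mv_ideal A J" shows "equiv (carrier A) (ideal_cong A J)"
proof (rule equivI)
  show "trans (ideal_cong A J)"
  proof (rule transI)
    fix x y z assume "(x, y) \<in> ideal_cong A J" "(y, z) \<in> ideal_cong A J"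
    then have *: "x \<in> carrier A" "y \<in> carrier A" "z \<in> carrier A" "x \<ominus> y \<in> J" "y \<ominus> x \<in> J" "y \<ominus> z \<in> J" "z \<ominus> y \<in> J"
      by (auto simp: ideal_cong_iff[OF J])
    have "x \<ominus> z \<in> J" "z \<ominus> x \<in> J"
      using * by (simp_all add: ideal_down[OF J ideal_plus[OF J] _ minus_triangle[of _ y]])
    then show "(x, z) \<in> ideal_cong A J" using * by (simp add: ideal_cong_iff[OF J])
  qed
  show "sym (ideal_cong A J)" by (rule symI) (simp add: ideal_cong_iff[OF J])
  show "refl_on (carrier A) (ideal_cong A J)"
    by (rule refl_onI) (simp add: ideal_cong_iff[OF J] ideal_zero[OF J])
  show "ideal_cong A J \<subseteq> carrier A \<times> carrier A" by (auto simp: ideal_cong_def)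
qed

lemma ideal_cong_plus:
  assumes J: "mv_ideal A J" and "(x, y) \<in> ideal_cong A J" "(z, w) \<in> ideal_cong A J"
  shows "(x \<oplus> z, y \<oplus> w) \<in> ideal_cong A J"
proof -
  have *: "x \<in> carrier A" "y \<in> carrier A" "z \<in> carrier A" "w \<in> carrier A"
    "x \<ominus> y \<in> J" "y \<ominus> x \<in> J" "z \<ominus> w \<in> J" "w \<ominus> z \<in> J"
    using assms by (auto simp: ideal_cong_iff[OF J])
  have "(x \<oplus> z) \<ominus> (y \<oplus> w) \<in> J" "(y \<oplus> w) \<ominus> (x \<oplus> z) \<in> J"
    using * by (simp_all add: ideal_down[OF J ideal_plus[OF J] _ minus_plus_plus])
  then show ?thesis using * by (simp add: ideal_cong_iff[OF J])
qed

lemma ideal_cong_neg: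
  assumes J: "mv_ideal A J" and "(x, y) \<in> ideal_cong A J"
  shows "(\<sim>x, \<sim>y) \<in> ideal_cong A J"
  using assms(2) by (simp add: ideal_cong_iff[OF J] neg_minus_neg)

end

section \<open>Quotients\<close>

locale mv_surj =
  fixes A :: "'a mv" and B :: "'b mv" and h :: "'a \<Rightarrow> 'b"
  assumes dom: "mv_algebra A" and cod: "mv_algebra B"
    and image: "h ` carrier A = carrier B"
    and hom_plus: "x \<in> carrier A \<Longrightarrow> y \<in> carrier A \<Longrightarrow> h (x \<oplus>\<^bsub>A\<^esub> y) = h x \<oplus>\<^bsub>B\<^esub> h y"
    and hom_zero: "h \<zero>\<^bsub>A\<^esub> = \<zero>\<^bsub>B\<^esub>"
    and hom_neg: "x \<in> carrier A \<Longrightarrow> h (mv_neg A x) = mv_neg B (h x)"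
begin

interpretation A: mv_algebra A by (rule dom)
interpretation B: mv_algebra B by (rule cod)

definition kernel :: "'a set" where "kernel = {x \<in> carrier A. h x = \<zero>\<^bsub>B\<^esub>}"
definition preimage :: "'b set \<Rightarrow> 'a set" where "preimage K = {x \<in> carrier A. h x \<in> K}"

lemma hom_closed [simp]: "x \<in> carrier A \<Longrightarrow> h x \<in> carrier B"
  using image by blast

lemma hom_minus:
  "x \<in> carrier A \<Longrightarrow> y \<in> carrier A \<Longrightarrow> h (mv_minus A x y) = mv_minus B (h x) (h y)"
  by (simp add: mv_minus_def hom_plus hom_neg)

lemma hom_le: "x \<in> carrier A \<Longrightarrow> y \<in> carrier A \<Longrightarrow> mv_le A x y \<Longrightarrow> mv_le B (h x) (h y)"
  using hom_minus[of x y] A.minus_zero_iff[of x y] B.minus_zero_iff[of "h x" "h y"]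
  by (simp add: hom_zero)

lemma hom_eval: "f \<in> UNIV \<rightarrow> carrier A \<Longrightarrow> mv_eval B (\<lambda>v. h (f v)) t = h (mv_eval A f t)"
  by (induction t) (simp_all add: hom_plus hom_zero hom_neg mv_eval_closed[OF dom])

lemma hom_multiple: "x \<in> carrier A \<Longrightarrow> h (A.multiple n x) = B.multiple n (h x)"
  by (induction n) (simp_all add: hom_plus hom_zero)

lemma preimage_ideal:
  assumes K: "mv_ideal B K" shows "mv_ideal A (preimage K)" "kernel \<subseteq> preimage K"
proof -
  show "kernel \<subseteq> preimage K" using B.ideal_zero[OF K] by (auto simp: kernel_def preimage_def)
  show "mv_ideal A (preimage K)" unfolding mv_ideal_def
  proof (intro conjI ballI impI)
    have "\<zero>\<^bsub>A\<^esub> \<in> preimage K" using B.ideal_zero[OF K] by (simp add: preimage_def hom_zero)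
    then show "preimage K \<noteq> {}" by blast
    show "x \<in> preimage K" if "x \<in> carrier A" "y \<in> preimage K" "mv_le A x y" for x y
      using that B.ideal_down[OF K, of "h y" "h x"] hom_le[of x y] by (simp add: preimage_def)
    show "x \<oplus>\<^bsub>A\<^esub> y \<in> preimage K" if "x \<in> preimage K" "y \<in> preimage K" for x y
      using that B.ideal_plus[OF K] by (simp add: preimage_def hom_plus)
  qed (simp add: preimage_def)
qed

lemma image_preimage: "K \<subseteq> carrier B \<Longrightarrow> h ` preimage K = K"
  unfolding preimage_def image[symmetric] by auto

text \<open>If \<open>h x = h y\<close> with \<open>y \<in> J\<close>, then \<open>x \<ominus> y\<close> is in the kernel, hence in \<open>J\<close>, and so is \<open>x \<le> y \<oplus> (x \<ominus> y)\<close>.\<close>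

lemma preimage_image:
  assumes J: "mv_ideal A J" "kernel \<subseteq> J" shows "preimage (h ` J) = J"
proof (intro equalityI subsetI)
  fix x assume "x \<in> preimage (h ` J)"
  then obtain y where xy: "x \<in> carrier A" "y \<in> J" "h x = h y" by (auto simp: preimage_def)
  have y: "y \<in> carrier A" using A.ideal_subset[OF J(1)] xy by simp
  have "h (mv_minus A x y) = \<zero>\<^bsub>B\<^esub>" using xy y by (simp add: hom_minus)
  then have "mv_minus A x y \<in> J" using J xy y by (auto simp: kernel_def)
  moreover have "mv_le A x (y \<oplus>\<^bsub>A\<^esub> mv_minus A x y)" using xy y by (simp add: A.minus_le_iff[symmetric])
  ultimately show "x \<in> J" using A.ideal_down[OF J(1) A.ideal_plus[OF J(1)]] xy by blast
qed (use A.ideal_subset[OF J(1)] in \<open>auto simp: preimage_def\<close>)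

lemma image_ideal:
  assumes J: "mv_ideal A J" shows "mv_ideal B (h ` J)"
  unfolding mv_ideal_def
proof (intro conjI ballI impI)
  note Jc = A.ideal_subset[OF J]
  show "h ` J \<subseteq> carrier B" using Jc by auto
  show "h ` J \<noteq> {}" using A.ideal_zero[OF J] by blast
  show "u \<oplus>\<^bsub>B\<^esub> v \<in> h ` J" if uv: "u \<in> h ` J" "v \<in> h ` J" for u v
  proof -
    obtain x y where "x \<in> J" "u = h x" "y \<in> J" "v = h y" using uv by blast
    then show ?thesis using Jc A.ideal_plus[OF J] hom_plus[of x y] by (metis imageI)
  qed
  show "u \<in> h ` J" if uv: "u \<in> carrier B" "v \<in> h ` J" "mv_le B u v" for u v
  proof -
    obtain x y where xy: "x \<in> carrier A" "u = h x" "y \<in> J" "v = h y" using uv image by blast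
    have y: "y \<in> carrier A" using xy Jc by simp
    have "mv_inf A x y \<in> J" using xy y A.ideal_down[OF J, of y "mv_inf A x y"] by simp
    moreover have "h (mv_inf A x y) = mv_inf B u v"
      using xy y by (simp add: A.inf_eq B.inf_eq hom_minus)
    moreover have "mv_inf B u v = u" using uv xy y by (simp add: B.inf_absorb1)
    ultimately show ?thesis by (metis imageI)
  qed
qed

lemma one_in_preimage_iff: "mv_neg A \<zero>\<^bsub>A\<^esub> \<in> preimage K \<longleftrightarrow> mv_neg B \<zero>\<^bsub>B\<^esub> \<in> K"
  by (simp add: preimage_def hom_neg hom_zero)

lemma preimage_Max:
  assumes M: "M \<in> mv_Max B" shows "preimage M \<in> mv_Max A"
proof -
  have id: "mv_ideal B M" and one: "mv_neg B \<zero>\<^bsub>B\<^esub> \<notin> M"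
    and mx: "\<And>K. mv_ideal B K \<Longrightarrow> mv_neg B \<zero>\<^bsub>B\<^esub> \<notin> K \<Longrightarrow> M \<subseteq> K \<Longrightarrow> K = M"
    using M unfolding B.Max_iff B.avoiding_def by blast+
  have "J = preimage M" if J: "mv_ideal A J" "mv_neg A \<zero>\<^bsub>A\<^esub> \<notin> J" "preimage M \<subseteq> J" for J
  proof -
    have pre: "preimage (h ` J) = J" using J preimage_ideal[OF id] by (intro preimage_image) auto
    have "M = h ` preimage M" using id by (subst image_preimage) (auto simp: B.ideal_subset)
    then have "M \<subseteq> h ` J" using J(3) by blast
    moreover have "mv_neg B \<zero>\<^bsub>B\<^esub> \<notin> h ` J" using J(2) pre one_in_preimage_iff[of "h ` J"] by simp
    ultimately have "h ` J = M" using mx image_ideal[OF J(1)] by blast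
    then show ?thesis using pre by simp
  qed
  then show ?thesis unfolding A.Max_iff A.avoiding_def
    using preimage_ideal[OF id] one one_in_preimage_iff[of M] by blast
qed

lemma image_Max:
  assumes M: "M \<in> mv_Max A" "kernel \<subseteq> M" shows "h ` M \<in> mv_Max B"
proof -
  have id: "mv_ideal A M" and one: "mv_neg A \<zero>\<^bsub>A\<^esub> \<notin> M"
    and mx: "\<And>K. mv_ideal A K \<Longrightarrow> mv_neg A \<zero>\<^bsub>A\<^esub> \<notin> K \<Longrightarrow> M \<subseteq> K \<Longrightarrow> K = M"
    using M unfolding A.Max_iff A.avoiding_def by blast+
  have pre: "preimage (h ` M) = M" using id M by (intro preimage_image)
  have "K = h ` M" if K: "mv_ideal B K" "mv_neg B \<zero>\<^bsub>B\<^esub> \<notin> K" "h ` M \<subseteq> K" for K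
  proof -
    have "preimage (h ` M) \<subseteq> preimage K" using K(3) by (auto simp: preimage_def)
    then have "preimage K = M"
      using mx[of "preimage K"] K preimage_ideal[OF K(1)] one_in_preimage_iff[of K] pre by blast
    then show ?thesis using image_preimage[of K] B.ideal_subset[OF K(1)] by blast
  qed
  then show ?thesis unfolding B.Max_iff B.avoiding_def
    using image_ideal[OF id] one one_in_preimage_iff[of "h ` M"] pre by blast
qed

lemma preimage_Rad: "preimage (mv_Rad B) = {x \<in> carrier A. \<forall>M\<in>mv_Max A. kernel \<subseteq> M \<longrightarrow> x \<in> M}"
proof (intro equalityI subsetI)
  fix x assume x: "x \<in> preimage (mv_Rad B)"
  have "x \<in> M" if M: "M \<in> mv_Max A" "kernel \<subseteq> M" for M
  proof -
    have "x \<in> preimage (h ` M)" using x image_Max[OF M] by (auto simp: preimage_def mv_Rad_def)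
    then show ?thesis using preimage_image M by (simp add: mv_Max_def)
  qed
  then show "x \<in> {x \<in> carrier A. \<forall>M\<in>mv_Max A. kernel \<subseteq> M \<longrightarrow> x \<in> M}"
    using x by (simp add: preimage_def)
next
  fix x assume x: "x \<in> {x \<in> carrier A. \<forall>M\<in>mv_Max A. kernel \<subseteq> M \<longrightarrow> x \<in> M}"
  have "h x \<in> M" if M: "M \<in> mv_Max B" for M
  proof -
    have "mv_ideal B M" using M by (simp add: mv_Max_def)
    then have "x \<in> preimage M" using x preimage_Max[OF M] preimage_ideal by blast
    then show ?thesis by (simp add: preimage_def)
  qed
  then show "x \<in> preimage (mv_Rad B)" using x by (simp add: preimage_def mv_Rad_def)
qed

lemma hom_ideal_cong:
  "x \<in> carrier A \<Longrightarrow> y \<in> carrier A \<Longrightarrow>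
    (x, y) \<in> ideal_cong A (preimage K) \<longleftrightarrow> (h x, h y) \<in> ideal_cong B K"
  by (simp add: ideal_cong_def preimage_def hom_plus hom_minus)

text \<open>The third isomorphism theorem, as far as cardinalities see it.\<close>

lemma quotient_preimage_bij:
  assumes K: "mv_ideal B K"
  shows "bij_betw ((`) h) (carrier (mv_ideal_quot A (preimage K))) (carrier (mv_ideal_quot B K))"
proof -
  let ?r = "ideal_cong A (preimage K)" and ?s = "ideal_cong B K"
  note eA = A.ideal_cong_equiv[OF preimage_ideal(1)[OF K]] and eB = B.ideal_cong_equiv[OF K]
  have cls: "h ` (?r `` {x}) = ?s `` {h x}" if x: "x \<in> carrier A" for x
  proof (intro equalityI subsetI)
    fix u assume "u \<in> ?s `` {h x}"
    then have u: "(h x, u) \<in> ?s" by simp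
    then obtain y where "y \<in> carrier A" "u = h y" using image by (auto simp: ideal_cong_def)
    then show "u \<in> h ` (?r `` {x})" using u x hom_ideal_cong by auto
  next
    fix u assume "u \<in> h ` (?r `` {x})"
    then obtain y where "(x, y) \<in> ?r" "u = h y" by blast
    moreover from this have "y \<in> carrier A" by (simp add: ideal_cong_def)
    ultimately show "u \<in> ?s `` {h x}" using x hom_ideal_cong by auto
  qed
  have cA: "carrier (mv_ideal_quot A (preimage K)) = (\<lambda>x. ?r `` {x}) ` carrier A"
    by (auto simp: mv_ideal_quot_def mv_quot_def quotient_def)
  have "carrier (mv_ideal_quot B K) = (\<lambda>u. ?s `` {u}) ` h ` carrier A"
    by (auto simp: mv_ideal_quot_def mv_quot_def quotient_def image)
  then have cB: "carrier (mv_ideal_quot B K) = (`) h ` carrier (mv_ideal_quot A (preimage K))"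
    by (simp add: cA image_image cls)
  have "inj_on ((`) h) (carrier (mv_ideal_quot A (preimage K)))"
  proof (rule inj_onI)
    fix C D assume "C \<in> carrier (mv_ideal_quot A (preimage K))" "D \<in> carrier (mv_ideal_quot A (preimage K))"
      and eq: "h ` C = h ` D"
    then obtain x y where xy: "x \<in> carrier A" "C = ?r `` {x}" "y \<in> carrier A" "D = ?r `` {y}"
      by (auto simp: cA)
    then have "?s `` {h x} = ?s `` {h y}" using eq cls by simp
    then have "(h x, h y) \<in> ?s" using xy eq_equiv_class[OF _ eB] by simp
    then show "C = D" using xy hom_ideal_cong equiv_class_eq[OF eA] by simp
  qed
  then show ?thesis by (simp add: bij_betw_def cB)
qed

end

text \<open>The operations on classes need representatives to be chosen only up to the relation; after that every
axiom of the quotient is the image of an axiom of \<open>A\<close>.\<close>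

lemma mv_surj_quot:
  assumes A: "mv_algebra A" and eq: "equiv (carrier A) r"
    and plus: "\<And>x y z w. (x, y) \<in> r \<Longrightarrow> (z, w) \<in> r \<Longrightarrow> (x \<oplus>\<^bsub>A\<^esub> z, y \<oplus>\<^bsub>A\<^esub> w) \<in> r"
    and neg: "\<And>x y. (x, y) \<in> r \<Longrightarrow> (mv_neg A x, mv_neg A y) \<in> r"
  shows "mv_surj A (mv_quot A r) (\<lambda>x. r `` {x})"
proof -
  interpret A: mv_algebra A by (rule A)
  let ?B = "mv_quot A r" and ?h = "\<lambda>x. r `` {x}"
  have carr: "carrier ?B = ?h ` carrier A" by (auto simp: mv_quot_def quotient_def)
  have im: "r `` S = ?h x" if "x \<in> S" "\<And>y. y \<in> S \<Longrightarrow> (x, y) \<in> r" for S x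
    using that equiv_class_eq[OF eq] by blast
  have self: "(x, x) \<in> r" if "x \<in> carrier A" for x
    using that eq by (auto elim: equivE dest: refl_onD)
  have hp: "?h (x \<oplus>\<^bsub>A\<^esub> y) = ?h x \<oplus>\<^bsub>?B\<^esub> ?h y" if "x \<in> carrier A" "y \<in> carrier A" for x y
  proof -
    have "r `` {u \<oplus>\<^bsub>A\<^esub> v | u v. u \<in> ?h x \<and> v \<in> ?h y} = ?h (x \<oplus>\<^bsub>A\<^esub> y)"
      by (rule im) (use that self plus in blast)+
    then show ?thesis by (simp add: mv_quot_def)
  qed
  have hn: "?h (mv_neg A x) = mv_neg ?B (?h x)" if "x \<in> carrier A" for x
  proof -
    have "r `` (mv_neg A ` ?h x) = ?h (mv_neg A x)" by (rule im) (use that self neg in blast)+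
    then show ?thesis by (simp add: mv_quot_def)
  qed
  have hz: "?h \<zero>\<^bsub>A\<^esub> = \<zero>\<^bsub>?B\<^esub>" by (simp add: mv_quot_def)
  have "mv_algebra ?B"
  proof
    fix u v w assume "u \<in> carrier ?B" "v \<in> carrier ?B" "w \<in> carrier ?B"
    then obtain x y z where [simp]: "x \<in> carrier A" "u = ?h x" "y \<in> carrier A" "v = ?h y"
      "z \<in> carrier A" "w = ?h z" by (auto simp: carr)
    show "(u \<oplus>\<^bsub>?B\<^esub> v) \<oplus>\<^bsub>?B\<^esub> w = u \<oplus>\<^bsub>?B\<^esub> (v \<oplus>\<^bsub>?B\<^esub> w)"
      by (simp add: hp[symmetric] A.plus_assoc)
  next
    fix u v assume "u \<in> carrier ?B" "v \<in> carrier ?B"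
    then obtain x y where [simp]: "x \<in> carrier A" "u = ?h x" "y \<in> carrier A" "v = ?h y"
      by (auto simp: carr)
    show "u \<oplus>\<^bsub>?B\<^esub> v \<in> carrier ?B" by (simp add: hp[symmetric] carr)
    show "u \<oplus>\<^bsub>?B\<^esub> v = v \<oplus>\<^bsub>?B\<^esub> u" by (simp add: hp[symmetric] A.plus_comm)
    show "mv_sup ?B u v = mv_sup ?B v u"
      using A.sup_comm[of x y] by (simp add: mv_sup_def hp[symmetric] hn[symmetric])
  next
    fix u assume "u \<in> carrier ?B"
    then obtain x where [simp]: "x \<in> carrier A" "u = ?h x" by (auto simp: carr)
    show "mv_neg ?B u \<in> carrier ?B" by (simp add: hn[symmetric] carr)
    show "u \<oplus>\<^bsub>?B\<^esub> \<zero>\<^bsub>?B\<^esub> = u" by (simp add: hp[symmetric] hz[symmetric])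
    show "mv_neg ?B (mv_neg ?B u) = u" by (simp add: hn[symmetric])
    show "u \<oplus>\<^bsub>?B\<^esub> mv_neg ?B \<zero>\<^bsub>?B\<^esub> = mv_neg ?B \<zero>\<^bsub>?B\<^esub>"
      by (simp add: hp[symmetric] hz[symmetric] hn[symmetric])
  qed (simp add: carr hz[symmetric])
  then show ?thesis by (rule mv_surj.intro[OF A]) (simp_all only: carr hp hn hz)
qed

lemma mv_surj_ideal_quot:
  assumes A: "mv_algebra A" and J: "mv_ideal A J"
  shows "mv_surj A (mv_ideal_quot A J) (\<lambda>x. ideal_cong A J `` {x})"
proof -
  interpret mv_algebra A by (rule A)
  show ?thesis unfolding mv_ideal_quot_def
    by (intro mv_surj_quot A ideal_cong_equiv ideal_cong_plus ideal_cong_neg J)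
qed

lemma kernel_ideal_quot:
  assumes A: "mv_algebra A" and J: "mv_ideal A J"
  shows "mv_surj.kernel A (mv_ideal_quot A J) (\<lambda>x. ideal_cong A J `` {x}) = J"
proof -
  interpret mv_algebra A by (rule A)
  interpret Q: mv_surj A "mv_ideal_quot A J" "\<lambda>x. ideal_cong A J `` {x}"
    by (rule mv_surj_ideal_quot[OF A J])
  have "ideal_cong A J `` {x} = ideal_cong A J `` {\<zero>\<^bsub>A\<^esub>} \<longleftrightarrow> x \<in> J" if x: "x \<in> carrier A" for x
    using x eq_equiv_class_iff[OF ideal_cong_equiv[OF J] x zero_closed]
    by (simp add: ideal_cong_iff[OF J] ideal_zero[OF J])
  then show ?thesis
    using ideal_subset[OF J] unfolding Q.kernel_def Q.hom_zero[symmetric] by blast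
qed

section \<open>Rank\<close>

text \<open>The radical classes of \<open>A / P\<close> are the elements of \<open>A / M\<close>, where \<open>M\<close> is the maximal ideal
  above \<open>P\<close>: since \<open>M\<close> is the only one, it is the preimage of the radical of \<open>A / P\<close>.\<close>

lemma ideal_has_rank_iff:
  assumes A: "mv_algebra A" and P: "P \<in> mv_Spec A" and M: "M \<in> mv_Max A" "P \<subseteq> M"
  shows "ideal_has_rank A P n \<longleftrightarrow>
    finite (carrier (mv_ideal_quot A M)) \<and> card (carrier (mv_ideal_quot A M)) = n + 1"
proof -
  interpret mv_algebra A by (rule A)
  have id: "mv_ideal A P" "mv_ideal A M" using P M by (simp_all add: mv_Spec_def mv_Max_def)
  interpret Q: mv_surj A "mv_ideal_quot A P" "\<lambda>x. ideal_cong A P `` {x}"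
    by (rule mv_surj_ideal_quot[OF A id(1)])
  interpret B: mv_algebra "mv_ideal_quot A P" by (rule Q.cod)
  have "{x \<in> carrier A. \<forall>N\<in>mv_Max A. P \<subseteq> N \<longrightarrow> x \<in> N} = M"
    using M Max_above_prime_unique[OF P _ _ M] ideal_subset[OF id(2)] by blast
  then have "Q.preimage (mv_Rad (mv_ideal_quot A P)) = M"
    unfolding Q.preimage_Rad kernel_ideal_quot[OF A id(1)] .
  then have "bij_betw ((`) (\<lambda>x. ideal_cong A P `` {x})) (carrier (mv_ideal_quot A M))
      (radical_classes (mv_ideal_quot A P))"
    using Q.quotient_preimage_bij[OF B.Rad_ideal] by (simp add: radical_classes_def)
  then show ?thesis unfolding ideal_has_rank_def has_rank_def
    using bij_betw_finite bij_betw_same_card by metis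
qed

lemma Max_ideal_has_rank_iff:
  assumes A: "mv_algebra A" and M: "M \<in> mv_Max A"
  shows "ideal_has_rank A M n \<longleftrightarrow>
    finite (carrier (mv_ideal_quot A M)) \<and> card (carrier (mv_ideal_quot A M)) = n + 1"
  using ideal_has_rank_iff[OF A _ M] mv_algebra.Max_subset_Spec[OF A] M by blast

lemma ideal_has_rank_Max_above:
  assumes A: "mv_algebra A" and P: "P \<in> mv_Spec A" and M: "M \<in> mv_Max A" "P \<subseteq> M"
  shows "ideal_has_rank A P n \<longleftrightarrow> ideal_has_rank A M n"
  using ideal_has_rank_iff[OF assms] Max_ideal_has_rank_iff[OF A M(1)] by simp

lemma (in mv_surj) ideal_has_rank_preimage:
  assumes M: "M \<in> mv_Max B"
  shows "ideal_has_rank A (preimage M) n \<longleftrightarrow> ideal_has_rank B M n"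
proof -
  have "mv_ideal B M" using M by (simp add: mv_Max_def)
  from quotient_preimage_bij[OF this] show ?thesis
    unfolding Max_ideal_has_rank_iff[OF dom preimage_Max[OF M]] Max_ideal_has_rank_iff[OF cod M]
    using bij_betw_finite bij_betw_same_card by metis
qed

section \<open>Chains and their positions\<close>

locale mv_chain = mv_algebra +
  assumes linear: "x \<in> carrier A \<Longrightarrow> y \<in> carrier A \<Longrightarrow> mv_le A x y \<or> mv_le A y x"
    and nontrivial: "\<zero> \<noteq> mv_neg A \<zero>"

lemma mv_chain_prime_quot:
  assumes A: "mv_algebra A" and P: "P \<in> mv_Spec A"
  shows "mv_chain (mv_ideal_quot A P)"
proof -
  interpret mv_algebra A by (rule A)
  have id: "mv_ideal A P" and one: "\<^bold>1 \<notin> P"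
    and lin: "\<And>x y. x \<in> carrier A \<Longrightarrow> y \<in> carrier A \<Longrightarrow> x \<ominus> y \<in> P \<or> y \<ominus> x \<in> P"
    using P unfolding Spec_iff by blast+
  let ?B = "mv_ideal_quot A P" and ?h = "\<lambda>x. ideal_cong A P `` {x}"
  interpret Q: mv_surj A ?B ?h by (rule mv_surj_ideal_quot[OF A id])
  interpret B: mv_algebra ?B by (rule Q.cod)
  have ker: "x \<in> P \<longleftrightarrow> x \<in> carrier A \<and> ?h x = \<zero>\<^bsub>?B\<^esub>" for x
    using kernel_ideal_quot[OF A id] unfolding Q.kernel_def by blast
  show ?thesis
  proof
    fix u v assume "u \<in> carrier ?B" "v \<in> carrier ?B"
    then obtain x y where xy: "x \<in> carrier A" "u = ?h x" "y \<in> carrier A" "v = ?h y"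
      unfolding Q.image[symmetric] by blast
    then have "mv_minus ?B u v = \<zero>\<^bsub>?B\<^esub> \<or> mv_minus ?B v u = \<zero>\<^bsub>?B\<^esub>"
      using lin[of x y] by (simp add: ker Q.hom_minus)
    then show "mv_le ?B u v \<or> mv_le ?B v u" using xy Q.hom_closed by (simp add: B.minus_zero_iff)
  next
    show "\<zero>\<^bsub>?B\<^esub> \<noteq> mv_neg ?B \<zero>\<^bsub>?B\<^esub>"
      using one by (simp add: ker Q.hom_neg Q.hom_zero)
  qed
qed

lemma (in mv_surj) mv_chain_image:
  assumes "mv_chain A" "\<zero>\<^bsub>B\<^esub> \<noteq> mv_neg B \<zero>\<^bsub>B\<^esub>" shows "mv_chain B"
proof -
  interpret A: mv_chain A by fact
  interpret B: mv_algebra B by (rule cod)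
  show ?thesis
  proof
    fix u v assume "u \<in> carrier B" "v \<in> carrier B"
    then obtain x y where "x \<in> carrier A" "u = h x" "y \<in> carrier A" "v = h y"
      unfolding image[symmetric] by blast
    then show "mv_le B u v \<or> mv_le B v u" using A.linear[of x y] hom_le by blast
  qed (fact assms(2))
qed

lemma (in mv_surj) satisfies_image:
  assumes "satisfies A E" shows "satisfies B E"
  unfolding satisfies_def
proof (safe)
  fix s t and f :: "nat \<Rightarrow> 'b" assume st: "(s, t) \<in> E" and f: "f \<in> UNIV \<rightarrow> carrier B"
  have "\<forall>v. \<exists>x. x \<in> carrier A \<and> f v = h x" using f image by blast
  then obtain g where g: "\<And>v. g v \<in> carrier A" "\<And>v. f v = h (g v)" by metis
  then have "mv_eval A g s = mv_eval A g t" using assms st by (auto simp: satisfies_def)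
  moreover have "f = (\<lambda>v. h (g v))" using g by auto
  moreover have "g \<in> UNIV \<rightarrow> carrier A" using g by auto
  ultimately show "mv_eval B f s = mv_eval B f t" using hom_eval[of g] by simp
qed

context mv_chain
begin

text \<open>In a chain a sum different from the top is not truncated; this is why summands can be cancelled in it.\<close>

lemma le_neg_of_plus_ne_one:
  "x \<in> carrier A \<Longrightarrow> y \<in> carrier A \<Longrightarrow> x \<oplus> y \<noteq> \<^bold>1 \<Longrightarrow> y \<preceq> \<sim>x"
  using linear[of "\<sim>x" y] by (simp add: neg_le_iff)

lemma plus_minus_cancel:
  assumes "x \<in> carrier A" "y \<in> carrier A" "x \<oplus> y \<noteq> \<^bold>1" shows "(x \<oplus> y) \<ominus> x = y"
  using assms le_neg_of_plus_ne_one[of x y] plus_minus_eq_inf[of y x]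
  by (simp add: plus_comm[of x] inf_absorb1)

text \<open>In the Lukasiewicz chain \<open>{0, 1/n, ..., 1}\<close> the position of \<open>k/n\<close> is \<open>k\<close>; counting the smaller elements
recovers this numerator from the order alone.\<close>

definition below :: "'a \<Rightarrow> 'a set" where "below x = {y \<in> carrier A. y \<preceq> x \<and> y \<noteq> x}"
definition position :: "'a \<Rightarrow> nat" where "position x = card (below x)"

lemma below_zero: "below \<zero> = {}"
  by (auto simp: below_def)

lemma not_in_below_iff: "x \<in> carrier A \<Longrightarrow> y \<in> carrier A \<Longrightarrow> y \<notin> below x \<longleftrightarrow> x \<preceq> y"
  using linear[of x y] le_antisym[of x y] by (auto simp: below_def)

end

locale finite_mv_chain = mv_chain +
  fixes n :: nat
  assumes card_carrier: "card (carrier A) = n + 1"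
begin

lemma finite_carrier: "finite (carrier A)"
  using card_carrier card_ge_0_finite by force

lemma finite_below: "finite (below x)"
  using finite_carrier by (simp add: below_def)

lemma position_neg:
  assumes x: "x \<in> carrier A" shows "position x + position (\<sim>x) = n"
proof -
  define above where "above = {y \<in> carrier A. x \<preceq> y \<and> y \<noteq> x}"
  have "below (\<sim>x) = mv_neg A ` above"
  proof (intro equalityI subsetI)
    fix y assume "y \<in> below (\<sim>x)"
    then have "y = \<sim>(\<sim>y)" "\<sim>y \<in> carrier A" "x \<preceq> \<sim>y" "\<sim>y \<noteq> x"
      using x neg_le_neg_iff[of "\<sim>y" x] by (auto simp: below_def)
    then show "y \<in> mv_neg A ` above" unfolding above_def by blast
  qed (use x in \<open>auto simp: above_def below_def neg_eq_iff\<close>)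
  moreover have "inj_on (mv_neg A) above"
    by (auto simp: above_def inj_on_def neg_eq_iff)
  ultimately have neg: "position (\<sim>x) = card above"
    by (simp add: position_def card_image)
  have carr: "carrier A = insert x (below x \<union> above)"
    using x linear[OF x] unfolding below_def above_def by blast
  have "below x \<inter> above = {}" "x \<notin> below x \<union> above"
    using x le_antisym unfolding below_def above_def by blast+
  moreover have "finite above" using finite_carrier by (simp add: above_def)
  ultimately have "card (carrier A) = Suc (card (below x) + card above)"
    by (subst carr) (simp add: finite_below card_Un_disjoint)
  then show ?thesis using neg card_carrier by (simp add: position_def)
qed

lemma position_le: "x \<in> carrier A \<Longrightarrow> position x \<le> n"
  using position_neg[of x] by simp

lemma position_mono:
  assumes "x \<in> carrier A" "y \<in> carrier A" "x \<preceq> y" "x \<noteq> y" shows "position x < position y"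
proof -
  have "below x \<subset> below y"
    using assms le_trans[of _ x y] le_antisym[of x y] by (auto simp: below_def)
  then show ?thesis unfolding position_def by (intro psubset_card_mono finite_below)
qed

lemma inj_position: "inj_on position (carrier A)"
  using linear position_mono by (metis inj_onI less_irrefl)

lemma position_zero [simp]: "position \<zero> = 0"
  by (simp add: position_def below_zero)

lemma position_one: "position \<^bold>1 = n"
  using position_neg[of \<zero>] by simp

text \<open>When \<open>x \<oplus> y\<close> is not truncated, \<open>w \<mapsto> x \<oplus> w\<close> maps the elements below \<open>y\<close> bijectively onto those
  between \<open>x\<close> and \<open>x \<oplus> y\<close>.\<close>

lemma position_plus_of_ne_one:
  assumes x: "x \<in> carrier A" and y: "y \<in> carrier A" and ne: "x \<oplus> y \<noteq> \<^bold>1"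
  shows "position (x \<oplus> y) = position x + position y"
proof -
  let ?f = "\<lambda>w. x \<oplus> w"
  have w: "w \<in> carrier A" "w \<preceq> y" "w \<noteq> y" "(x \<oplus> w) \<ominus> x = w" "x \<oplus> w \<preceq> x \<oplus> y" if "w \<in> below y" for w
  proof -
    show w: "w \<in> carrier A" "w \<preceq> y" "w \<noteq> y" using that by (auto simp: below_def)
    show le: "x \<oplus> w \<preceq> x \<oplus> y" using w x y plus_mono_right by simp
    then have "x \<oplus> w \<noteq> \<^bold>1" using ne x y by auto
    then show "(x \<oplus> w) \<ominus> x = w" using plus_minus_cancel w x by simp
  qed
  have inj: "inj_on ?f (below y)" using w(4) by (metis inj_onI)
  have disj: "below x \<inter> ?f ` below y = {}"
  proof -
    have "x \<oplus> v \<notin> below x" if "v \<in> below y" for v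
      using not_in_below_iff[of x "x \<oplus> v"] w(1)[OF that] x by simp
    then show ?thesis by blast
  qed
  have xy: "(x \<oplus> y) \<ominus> x = y" using plus_minus_cancel[OF x y ne] .
  have "below (x \<oplus> y) = below x \<union> ?f ` below y"
  proof (intro equalityI subsetI)
    fix z assume z: "z \<in> below (x \<oplus> y)"
    then have zc: "z \<in> carrier A" "z \<preceq> x \<oplus> y" "z \<noteq> x \<oplus> y" by (auto simp: below_def)
    show "z \<in> below x \<union> ?f ` below y"
    proof (cases "x \<preceq> z")
      case True
      then have "z = x \<oplus> (z \<ominus> x)" using minus_plus_of_le[of x z] x zc by (simp add: plus_comm)
      moreover have "z \<ominus> x \<in> below y"
        using x y zc calculation by (auto simp: below_def minus_le_iff)
      ultimately show ?thesis by blast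
    next
      case False
      then show ?thesis using not_in_below_iff[OF x zc(1)] by blast
    qed
  next
    fix z assume "z \<in> below x \<union> ?f ` below y"
    then show "z \<in> below (x \<oplus> y)"
    proof
      assume "z \<in> below x"
      then have "z \<in> carrier A" "z \<preceq> x" "z \<noteq> x" by (auto simp: below_def)
      then show ?thesis using x y le_trans[of z x "x \<oplus> y"] le_antisym[of z x] le_plus[of x y]
        by (auto simp: below_def)
    next
      assume "z \<in> ?f ` below y"
      then obtain v where "v \<in> below y" "z = x \<oplus> v" by blast
      moreover from this have "x \<oplus> v \<noteq> x \<oplus> y" using w(3,4)[of v] xy by metis
      ultimately show ?thesis using w(1,5)[of v] x by (simp add: below_def)
    qed
  qed
  then show ?thesis
    using finite_below disj inj by (simp add: position_def card_Un_disjoint card_image)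
qed

text \<open>If the sum reaches the top, then \<open>\<not>x \<le> y\<close>, and the positions of \<open>x\<close> and \<open>y\<close> add up to at least \<open>n\<close>.
  Together with \<open>position_neg\<close> and \<open>inj_position\<close> this identifies a chain of \<open>n + 1\<close> elements with the
  Lukasiewicz chain \<open>{0, ..., n}\<close>.\<close>

lemma position_plus:
  assumes x: "x \<in> carrier A" and y: "y \<in> carrier A"
  shows "position (x \<oplus> y) = min n (position x + position y)"
proof (cases "x \<oplus> y = \<^bold>1")
  case True
  then have "\<sim>x \<preceq> y" using x y by (simp add: neg_le_iff)
  then have "position (\<sim>x) \<le> position y" using x y position_mono[of "\<sim>x" y] by fastforce
  then show ?thesis using True position_neg[OF x] position_one by simp
next
  case False
  then show ?thesis using position_plus_of_ne_one[OF x y] position_le[of "x \<oplus> y"] x y by simp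
qed

lemma ex_position: "k \<le> n \<Longrightarrow> \<exists>x\<in>carrier A. position x = k"
proof -
  assume k: "k \<le> n"
  have "position ` carrier A = {..n}"
    using position_le card_image[OF inj_position] card_carrier
    by (intro card_subset_eq) auto
  then show ?thesis using k by (metis (no_types, lifting) atMost_iff imageE)
qed

lemma n_pos: "n > 0"
proof (rule ccontr)
  assume "\<not> n > 0"
  then have "position \<zero> = position \<^bold>1" using position_one by simp
  then show False using inj_position nontrivial by (metis inj_on_def neg_closed zero_closed)
qed

lemma position_multiple: "x \<in> carrier A \<Longrightarrow> position (multiple k x) = min n (k * position x)"
  by (induction k) (auto simp: position_plus)

end

section \<open>Identities of Komori chains\<close>

definition minus_term :: "'v mv_term \<Rightarrow> 'v mv_term \<Rightarrow> 'v mv_term" where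
  "minus_term s t = Neg (Plus (Neg s) t)"

definition dist_term :: "'v mv_term \<Rightarrow> 'v mv_term \<Rightarrow> 'v mv_term" where
  "dist_term s t = Plus (minus_term s t) (minus_term t s)"

primrec multiple_term :: "nat \<Rightarrow> 'v mv_term \<Rightarrow> 'v mv_term" where
  "multiple_term 0 t = Zero"
| "multiple_term (Suc n) t = Plus t (multiple_term n t)"

definition sum_term :: "'v mv_term list \<Rightarrow> 'v mv_term" where
  "sum_term ts = foldr Plus ts Zero"

lemma eval_dist_term [simp]:
  "mv_eval A f (dist_term s t) =
    mv_minus A (mv_eval A f s) (mv_eval A f t) \<oplus>\<^bsub>A\<^esub> mv_minus A (mv_eval A f t) (mv_eval A f s)"
  by (simp add: dist_term_def minus_term_def mv_minus_def)

lemma (in mv_algebra) eval_multiple_term [simp]: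
  "mv_eval A f (multiple_term n t) = multiple n (mv_eval A f t)"
  by (induction n) auto

lemma (in mv_algebra) multiple_zero [simp]: "multiple n \<zero> = \<zero>"
  by (induction n) auto

lemma (in mv_algebra) eval_sum_term_zero:
  "(\<And>t. t \<in> set ts \<Longrightarrow> mv_eval A f t = \<zero>) \<Longrightarrow> mv_eval A f (sum_term ts) = \<zero>"
  by (induction ts) (auto simp: sum_term_def)

text \<open>The first component is a homomorphism onto the Lukasiewicz chain \<open>{0, ..., m}\<close>.\<close>

lemma fst_plus_Komori: "fst (p \<oplus>\<^bsub>Komori m\<^esub> q) = min (fst p + fst q) (int m)"
  by (auto simp: plus_Komori min_def less_eq_prod_def)

lemma zero_Komori: "\<zero>\<^bsub>Komori m\<^esub> = 0"
  by (simp add: Komori_def Gamma_def)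

lemma plus_Komori_top:
  "fst p + fst q > int m \<Longrightarrow> p \<oplus>\<^bsub>Komori m\<^esub> q = mv_neg (Komori m) \<zero>\<^bsub>Komori m\<^esub>"
  by (auto simp: plus_Komori neg_Komori zero_Komori min_def less_eq_prod_def)

lemma fst_neg_Komori: "fst (mv_neg (Komori m) p) = int m - fst p"
  by (simp add: neg_Komori)

lemma fst_zero_Komori: "fst \<zero>\<^bsub>Komori m\<^esub> = 0"
  by (simp add: zero_Komori)

lemma fst_minus_Komori: "fst (mv_minus (Komori m) p q) = max (fst p - fst q) 0"
  by (auto simp: mv_minus_def fst_neg_Komori fst_plus_Komori)

lemma fst_bounds_Komori: "p \<in> carrier (Komori m) \<Longrightarrow> 0 \<le> fst p \<and> fst p \<le> int m"
  by (simp add: carrier_Komori)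

lemma fst_multiple_Komori:
  assumes "m > 0" "p \<in> carrier (Komori m)"
  shows "fst (mv_algebra.multiple (Komori m) n p) = min (int n * fst p) (int m)"
proof -
  interpret K: mv_algebra "Komori m" by (rule mv_algebra_Komori) fact
  show ?thesis
    using fst_bounds_Komori[OF assms(2)]
    by (induction n) (auto simp: fst_plus_Komori fst_zero_Komori algebra_simps min_def)
qed

lemma fst_eval_sum_term_Komori:
  assumes m: "m > 0" and f: "f \<in> UNIV \<rightarrow> carrier (Komori m)" and t: "t \<in> set ts"
  shows "fst (mv_eval (Komori m) f t) \<le> fst (mv_eval (Komori m) f (sum_term ts))"
  using t
proof (induction ts)
  case (Cons s ts)
  have b: "0 \<le> fst (mv_eval (Komori m) f s)" "fst (mv_eval (Komori m) f s) \<le> int m" for s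
    using fst_bounds_Komori[OF mv_eval_closed[OF mv_algebra_Komori[OF m] f]] by auto
  have "sum_term (s # ts) = Plus s (sum_term ts)" by (simp add: sum_term_def)
  then show ?case using Cons b[of s] b[of t] b[of "sum_term ts"] by (auto simp: fst_plus_Komori)
qed simp

text \<open>Among \<open>m + 2\<close> elements of \<open>K\<^sub>m\<close> two differ by an infinitesimal, by the pigeonhole principle
  for the first components. In a simple chain, all distances of distinct elements have
  multiples that reach the top.\<close>

lemma simple_chain_card_le:
  assumes m: "m > 0" and D: "mv_chain D"
    and simple: "\<And>x. x \<in> carrier D \<Longrightarrow> x \<noteq> \<zero>\<^bsub>D\<^esub> \<Longrightarrow> \<exists>k. mv_algebra.multiple D k x = mv_neg D \<zero>\<^bsub>D\<^esub>"
    and var: "\<And>E. satisfies (Komori m) E \<Longrightarrow> satisfies D E"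
  shows "finite (carrier D) \<and> card (carrier D) \<le> m + 1"
proof (rule ccontr)
  interpret D: mv_chain D by (rule D)
  interpret K: mv_algebra "Komori m" by (rule mv_algebra_Komori[OF m])
  let ?K = "Komori m"
  assume "\<not> ?thesis"
  then obtain S where S: "S \<subseteq> carrier D" "finite S" "card S = m + 2"
    using infinite_arbitrarily_large[of "carrier D" "m + 2"] obtain_subset_with_card_n[of "m + 2" "carrier D"]
    by (cases "finite (carrier D)") auto
  then obtain a where a: "bij_betw a {0..<m + 2} S"
    using ex_bij_betw_nat_finite[of S] by auto
  then have aS: "a i \<in> carrier D" if "i < m + 2" for i using that S by (auto simp: bij_betw_def)
  have "\<exists>k. mv_algebra.multiple D k (D.dist (a i) (a j)) = mv_neg D \<zero>\<^bsub>D\<^esub>"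
    if "i < m + 2" "j < m + 2" "i \<noteq> j" for i j
  proof (rule simple)
    show "D.dist (a i) (a j) \<noteq> \<zero>\<^bsub>D\<^esub>"
      using that aS a by (subst D.dist_zero_iff) (auto simp: bij_betw_def inj_on_def)
  qed (use that aS in simp)
  then obtain N where N: "\<And>i j. i < m + 2 \<Longrightarrow> j < m + 2 \<Longrightarrow> i \<noteq> j \<Longrightarrow>
      mv_algebra.multiple D (N i j) (D.dist (a i) (a j)) = mv_neg D \<zero>\<^bsub>D\<^esub>" by metis
  \<comment> \<open>The sum of the \<open>T i j\<close> is \<open>0\<close> in \<open>D\<close>, because the multiples \<open>N i j\<close> take all distances to the top. In \<open>K\<^sub>m\<close>
    some \<open>T i j\<close> is infinitely close to the top, so twice the sum is the top.\<close>
  define T where "T i j = Neg (multiple_term (N i j) (dist_term (Var i) (Var j)))" for i j :: nat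
  define ts where "ts = map (\<lambda>(i, j). T i j)
    (filter (\<lambda>(i, j). i \<noteq> j) (List.product [0..<m + 2] [0..<m + 2]))"
  have ts: "set ts = (\<lambda>(i, j). T i j) ` {(i, j). i < m + 2 \<and> j < m + 2 \<and> i \<noteq> j}"
    unfolding ts_def set_map set_filter set_product set_upt by (rule arg_cong) auto
  have "satisfies ?K {(Plus (sum_term ts) (sum_term ts), Neg Zero)}"
    unfolding satisfies_def
  proof safe
    fix f :: "nat \<Rightarrow> int \<times> int" assume f: "f \<in> UNIV \<rightarrow> carrier ?K"
    then have fK: "f i \<in> carrier ?K" for i by auto
    have "(\<lambda>i. fst (f i)) ` {0..<m + 2} \<subseteq> {0..int m}" using fst_bounds_Komori[OF fK] by auto
    then have "card ((\<lambda>i. fst (f i)) ` {0..<m + 2}) \<le> card {0..int m}"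
      by (intro card_mono) simp_all
    then have "card ((\<lambda>i. fst (f i)) ` {0..<m + 2}) \<noteq> card {0..<m + 2}" by simp
    then have "\<not> inj_on (\<lambda>i. fst (f i)) {0..<m + 2}" using card_image by blast
    then obtain i j where ij: "i < m + 2" "j < m + 2" "i \<noteq> j" "fst (f i) = fst (f j)"
      by (auto simp: inj_on_def)
    have "fst (mv_eval ?K f (T i j)) = int m"
      using fst_multiple_Komori[OF m, of "K.dist (f i) (f j)" "N i j"] ij fK
      by (simp add: T_def fst_neg_Komori fst_plus_Komori fst_minus_Komori)
    moreover have "T i j \<in> set ts"
      unfolding ts by (rule image_eqI[of _ _ "(i, j)"]) (use ij in simp_all)
    ultimately have "fst (mv_eval ?K f (sum_term ts)) \<ge> int m"
      using fst_eval_sum_term_Komori[OF m f, of "T i j" ts] by simp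
    then show "mv_eval ?K f (Plus (sum_term ts) (sum_term ts)) = mv_eval ?K f (Neg Zero)"
      using m by (simp add: plus_Komori_top)
  qed
  then have sat: "satisfies D {(Plus (sum_term ts) (sum_term ts), Neg Zero)}" by (rule var)
  define f where "f i = (if i < m + 2 then a i else \<zero>\<^bsub>D\<^esub>)" for i
  have "f \<in> UNIV \<rightarrow> carrier D" using aS by (auto simp: f_def)
  then have "mv_eval D f (Plus (sum_term ts) (sum_term ts)) = mv_eval D f (Neg Zero)"
    using sat by (auto simp: satisfies_def)
  moreover have "mv_eval D f (sum_term ts) = \<zero>\<^bsub>D\<^esub>"
    by (rule D.eval_sum_term_zero) (auto simp: ts T_def f_def N)
  ultimately show False using D.nontrivial by simp
qed

text \<open>In a chain of \<open>n + 1\<close> elements the atom \<open>x\<close> satisfies \<open>x = \<not>((n - 1) x)\<close>. In \<open>K\<^sub>m\<close>, comparing the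
  first components of both sides would give \<open>n j = m\<close> for an integer \<open>j\<close>; when \<open>n\<close> does not divide \<open>m\<close>, the
  distance of the two sides is therefore never infinitesimal, and its multiple by \<open>m + 1\<close> is the top.\<close>

lemma finite_chain_rank_dvd:
  assumes m: "m > 0" and D: "finite_mv_chain D n"
    and var: "\<And>E. satisfies (Komori m) E \<Longrightarrow> satisfies D E"
  shows "n dvd m"
proof (rule ccontr)
  interpret D: finite_mv_chain D n by (rule D)
  interpret K: mv_algebra "Komori m" by (rule mv_algebra_Komori[OF m])
  let ?K = "Komori m"
  assume ndvd: "\<not> n dvd m"
  define d :: "nat mv_term" where "d = dist_term (Var 0) (Neg (multiple_term (n - 1) (Var 0)))"
  have "satisfies ?K {(multiple_term (m + 1) d, Neg Zero)}"
    unfolding satisfies_def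
  proof safe
    fix f :: "nat \<Rightarrow> int \<times> int" assume f: "f \<in> UNIV \<rightarrow> carrier ?K"
    let ?e = "mv_eval ?K f d"
    have f0: "f 0 \<in> carrier ?K" using f by auto
    define j where "j = fst (f 0)"
    have j: "0 \<le> j" "j \<le> int m" using fst_bounds_Komori[OF f0] by (auto simp: j_def)
    have e: "?e \<in> carrier ?K" using mv_eval_closed[OF K.mv_algebra_axioms f] .
    have "int n * j \<noteq> int m" using ndvd by (metis dvd_triv_left int_dvd_int_iff)
    then have "int (n - 1) * j + j \<noteq> int m"
      using D.n_pos by (simp add: of_nat_diff algebra_simps)
    moreover define i where "i = int m - min (int (n - 1) * j) (int m)"
    ultimately have "j \<noteq> i" using j m by (auto simp: min_def)
    moreover have "fst ?e = min (max (j - i) 0 + max (i - j) 0) (int m)"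
      using fst_multiple_Komori[OF m f0, of "n - 1"]
      by (simp add: d_def fst_plus_Komori fst_minus_Komori fst_neg_Komori i_def j_def)
    ultimately have "fst ?e \<ge> 1" using m by (simp add: min_def max_def)
    moreover from this have "fst (K.multiple m ?e) = int m"
      using fst_multiple_Komori[OF m e, of m] m mult_left_mono[of 1 "fst ?e" "int m"] by simp
    ultimately show "mv_eval ?K f (multiple_term (m + 1) d) = mv_eval ?K f (Neg Zero)"
      by (simp add: plus_Komori_top)
  qed
  then have sat: "satisfies D {(multiple_term (m + 1) d, Neg Zero)}" by (rule var)
  obtain x where x: "x \<in> carrier D" "D.position x = 1"
    using D.ex_position[of 1] D.n_pos by auto
  have "D.position (mv_neg D (D.multiple (n - 1) x)) = 1"
    using D.position_neg[of "D.multiple (n - 1) x"] D.position_multiple[of x "n - 1"] x D.n_pos by simp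
  then have "mv_neg D (D.multiple (n - 1) x) = x"
    using x D.inj_position by (auto simp: inj_on_def)
  then have "mv_eval D (\<lambda>_. x) d = \<zero>\<^bsub>D\<^esub>" using x by (simp add: d_def)
  moreover have "mv_eval D (\<lambda>_. x) (multiple_term (m + 1) d) = mv_eval D (\<lambda>_. x) (Neg Zero)"
    using sat x by (auto simp: satisfies_def)
  ultimately show False using D.nontrivial by simp
qed

text \<open>Simplicity of \<open>A / M\<close> is the maximality of \<open>M\<close>, read in the quotient.\<close>

lemma Max_quot_simple:
  assumes A: "mv_algebra A" and M: "M \<in> mv_Max A" and D: "D = mv_ideal_quot A M"
    and u: "u \<in> carrier D" "u \<noteq> \<zero>\<^bsub>D\<^esub>"
  shows "\<exists>k. mv_algebra.multiple D k u = mv_neg D \<zero>\<^bsub>D\<^esub>"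
proof -
  interpret A: mv_algebra A by (rule A)
  have id: "mv_ideal A M" using M by (simp add: mv_Max_def)
  let ?h = "\<lambda>x. ideal_cong A M `` {x}"
  interpret Q: mv_surj A D ?h unfolding D by (rule mv_surj_ideal_quot[OF A id])
  interpret D: mv_algebra D by (rule Q.cod)
  have ker: "x \<in> M \<longleftrightarrow> x \<in> carrier A \<and> ?h x = \<zero>\<^bsub>D\<^esub>" for x
    using kernel_ideal_quot[OF A id, folded D] unfolding Q.kernel_def by blast
  obtain x where x: "x \<in> carrier A" "u = ?h x" using u Q.image by blast
  then have "x \<notin> M" using u ker by simp
  then obtain k where "mv_neg A (A.multiple k x) \<in> M" using A.Max_archimedean[OF M x(1)] by blast
  then have "mv_neg D (D.multiple k u) = \<zero>\<^bsub>D\<^esub>" using ker x by (simp add: Q.hom_neg Q.hom_multiple)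
  then have "D.multiple k u = mv_neg D \<zero>\<^bsub>D\<^esub>" using D.neg_neg[of "D.multiple k u"] u by simp
  then show ?thesis ..
qed

lemma Max_rank_dvd:
  assumes m: "m > 0" and A: "mv_algebra A" and M: "M \<in> mv_Max A"
    and var: "in_variety_of (Komori m) A"
  shows "\<exists>n. ideal_has_rank A M n \<and> n dvd m"
proof -
  have id: "mv_ideal A M" and P: "M \<in> mv_Spec A"
    using M mv_algebra.Max_subset_Spec[OF A] by (auto simp: mv_Max_def)
  define D where "D = mv_ideal_quot A M"
  interpret Q: mv_surj A D "\<lambda>x. ideal_cong A M `` {x}"
    unfolding D_def by (rule mv_surj_ideal_quot[OF A id])
  interpret D: mv_chain D unfolding D_def by (rule mv_chain_prime_quot[OF A P])
  have sat: "satisfies D E" if "satisfies (Komori m) E" for E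
    using that var Q.satisfies_image by (auto simp: in_variety_of_def)
  have fin: "finite (carrier D)"
    using simple_chain_card_le[OF m D.mv_chain_axioms Max_quot_simple[OF A M D_def] sat] by blast
  define n where "n = card (carrier D) - 1"
  have card: "card (carrier D) = n + 1"
  proof -
    have "card (carrier D) > 0" using fin D.zero_closed card_gt_0_iff by blast
    then show ?thesis by (simp add: n_def)
  qed
  then have "finite_mv_chain D n" by unfold_locales
  then have "n dvd m" using finite_chain_rank_dvd[OF m _ sat] by blast
  then show ?thesis using Max_ideal_has_rank_iff[OF A M] fin card D_def by blast
qed

section \<open>The Chang group of a chain\<close>

context mv_algebra
begin

lemma times_comm: "x \<in> carrier A \<Longrightarrow> y \<in> carrier A \<Longrightarrow> x \<odot> y = y \<odot> x"
  by (simp add: plus_comm)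

lemma neg_eq_swap: "x \<in> carrier A \<Longrightarrow> y \<in> carrier A \<Longrightarrow> \<sim>x = y \<longleftrightarrow> x = \<sim>y"
  by (metis neg_neg)

lemma times_eq_one_iff:
  "x \<in> carrier A \<Longrightarrow> y \<in> carrier A \<Longrightarrow> x \<odot> y = \<^bold>1 \<longleftrightarrow> x = \<^bold>1 \<and> y = \<^bold>1"
  using plus_zero_iff[of "\<sim>x" "\<sim>y"] by (simp add: neg_eq_iff neg_eq_swap)

text \<open>Here \<open>\<not>a = (\<not>a \<ominus> b) \<oplus> b\<close> and \<open>\<not>c = (\<not>c \<ominus> b) \<oplus> b\<close>, so both sides are the negation of
\<open>(\<not>a \<ominus> b) \<oplus> b \<oplus> (\<not>c \<ominus> b)\<close>. This and the next two lemmas are associativity of the Chang group,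
by cases on which partial sums carry.\<close>

lemma plus_times_swap_low:
  assumes c: "a \<in> carrier A" "b \<in> carrier A" "c \<in> carrier A" and ab: "b \<preceq> \<sim>a" and bc: "b \<preceq> \<sim>c"
  shows "(a \<oplus> b) \<odot> c = a \<odot> (b \<oplus> c)"
proof -
  have a: "(\<sim>a \<ominus> b) \<oplus> b = \<sim>a" and c': "(\<sim>c \<ominus> b) \<oplus> b = \<sim>c"
    using assms minus_plus_of_le by auto
  have "\<sim>(a \<oplus> b) \<oplus> \<sim>c = (\<sim>a \<ominus> b) \<oplus> ((\<sim>c \<ominus> b) \<oplus> b)"
    using c by (simp add: c') (simp add: mv_minus_def)
  also have "\<dots> = ((\<sim>a \<ominus> b) \<oplus> b) \<oplus> (\<sim>c \<ominus> b)" using c by (simp add: plus_ac)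
  also have "\<dots> = \<sim>a \<oplus> \<sim>(b \<oplus> c)" using c by (simp add: a) (simp add: mv_minus_def plus_comm)
  finally show ?thesis by simp
qed

text \<open>The previous lemma for \<open>\<not>a\<close>, \<open>\<not>b\<close>, \<open>\<not>c\<close>.\<close>

lemma plus_times_swap_high:
  assumes c: "a \<in> carrier A" "b \<in> carrier A" "c \<in> carrier A" and ab: "a \<oplus> b = \<^bold>1" and bc: "b \<oplus> c = \<^bold>1"
  shows "(a \<odot> b) \<oplus> c = a \<oplus> (b \<odot> c)"
proof -
  have "\<sim>b \<preceq> \<sim>(\<sim>a)" "\<sim>b \<preceq> \<sim>(\<sim>c)" using assms by (simp_all add: le_iff plus_comm)
  then have "(\<sim>a \<oplus> \<sim>b) \<odot> \<sim>c = \<sim>a \<odot> (\<sim>b \<oplus> \<sim>c)" using c by (intro plus_times_swap_low) auto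
  then show ?thesis using c by (simp add: neg_eq_iff)
qed

end

context mv_chain
begin

text \<open>Here \<open>\<not>c \<le> b \<le> \<not>a\<close>, so \<open>\<not>a\<close> is the sum of \<open>v = b \<odot> c\<close> and \<open>w = \<not>((a \<oplus> b) \<odot> c)\<close>. In a chain this sum can
  be cancelled unless it is the top, that is, unless \<open>a = 0\<close>.\<close>

lemma plus_times_swap_mixed:
  assumes c: "a \<in> carrier A" "b \<in> carrier A" "c \<in> carrier A" and ab: "b \<preceq> \<sim>a" and bc: "b \<oplus> c = \<^bold>1"
  shows "(a \<oplus> b) \<odot> c = a \<oplus> (b \<odot> c)"
proof (cases "a = \<zero>")
  case False
  define v w where "v = b \<ominus> \<sim>c" and "w = (\<sim>a \<ominus> b) \<oplus> \<sim>c"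
  have [simp]: "v \<in> carrier A" "w \<in> carrier A" using c by (auto simp: v_def w_def)
  have "\<sim>c \<preceq> b" using c bc by (simp add: le_iff plus_comm)
  then have b: "b = v \<oplus> \<sim>c" using c by (simp add: v_def minus_plus_of_le)
  have "\<sim>a = (\<sim>a \<ominus> b) \<oplus> b" using c ab by (simp add: minus_plus_of_le)
  also have "\<dots> = v \<oplus> w" using c unfolding w_def by (subst (2) b) (simp add: plus_ac)
  finally have vw: "\<sim>a = v \<oplus> w" .
  then have "v \<oplus> w \<noteq> \<^bold>1" using False c by (metis neg_eq_iff zero_closed)
  then have "\<sim>a \<ominus> v = w" using plus_minus_cancel[of v w] vw by simp
  then have "\<sim>w = a \<oplus> v" using c by (simp add: mv_minus_def neg_eq_swap)
  moreover have "\<sim>w = (a \<oplus> b) \<odot> c" using c by (simp add: w_def mv_minus_def)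
  ultimately show ?thesis using c by (simp add: v_def mv_minus_def)
qed (use c in simp)

text \<open>The pair \<open>(i, x)\<close> stands for \<open>i u + x\<close>, where \<open>u\<close> is the unit. The top of \<open>A\<close> is left out because it is
represented by \<open>(1, 0)\<close>; a sum that reaches the top carries one unit, and \<open>x \<odot> y\<close> is what remains of it.\<close>

definition chang_group :: "(int \<times> 'a) monoid" where
  "chang_group = \<lparr>carrier = UNIV \<times> (carrier A - {\<^bold>1}),
    mult = (\<lambda>(i, x) (j, y). if x \<oplus> y = \<^bold>1 then (i + j + 1, x \<odot> y) else (i + j, x \<oplus> y)),
    one = (0, \<zero>)\<rparr>"

lemma carrier_chang_group: "carrier chang_group = UNIV \<times> (carrier A - {\<^bold>1})"
  by (simp add: chang_group_def)

lemma one_chang_group: "\<one>\<^bsub>chang_group\<^esub> = (0, \<zero>)"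
  by (simp add: chang_group_def)

lemma mult_chang_group:
  "(i, x) \<otimes>\<^bsub>chang_group\<^esub> (j, y) = (if x \<oplus> y = \<^bold>1 then (i + j + 1, x \<odot> y) else (i + j, x \<oplus> y))"
  by (simp add: chang_group_def)

definition chang_inv :: "int \<times> 'a \<Rightarrow> int \<times> 'a" where
  "chang_inv = (\<lambda>(i, x). if x = \<zero> then (- i, \<zero>) else (- i - 1, \<sim>x))"

lemma neg_ne_one: "x \<in> carrier A \<Longrightarrow> x \<noteq> \<zero> \<Longrightarrow> \<sim>x \<noteq> \<^bold>1"
  by (simp add: neg_eq_iff)

lemma chang_inv:
  assumes "g \<in> carrier chang_group"
  shows "chang_inv g \<in> carrier chang_group" "chang_inv g \<otimes>\<^bsub>chang_group\<^esub> g = \<one>\<^bsub>chang_group\<^esub>"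
proof -
  obtain i x where g: "g = (i, x)" "x \<in> carrier A" "x \<noteq> \<^bold>1"
    using assms by (auto simp: carrier_chang_group)
  then show "chang_inv g \<in> carrier chang_group"
    using nontrivial neg_ne_one by (simp add: chang_inv_def carrier_chang_group)
  show "chang_inv g \<otimes>\<^bsub>chang_group\<^esub> g = \<one>\<^bsub>chang_group\<^esub>"
    using g nontrivial by (simp add: chang_inv_def mult_chang_group one_chang_group)
qed

lemma chang_assoc:
  assumes x: "x \<in> carrier A" "x \<noteq> \<^bold>1" and y: "y \<in> carrier A" "y \<noteq> \<^bold>1" and z: "z \<in> carrier A" "z \<noteq> \<^bold>1"
  shows "(i, x) \<otimes>\<^bsub>chang_group\<^esub> (j, y) \<otimes>\<^bsub>chang_group\<^esub> (k, z) =
    (i, x) \<otimes>\<^bsub>chang_group\<^esub> ((j, y) \<otimes>\<^bsub>chang_group\<^esub> (k, z))"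
proof -
  have times: "x \<odot> y \<odot> z = x \<odot> (y \<odot> z)" using x y z by (simp add: plus_assoc)
  have plus: "x \<oplus> y \<oplus> z = x \<oplus> (y \<oplus> z)" using x y z by (simp add: plus_assoc)
  consider "x \<oplus> y \<noteq> \<^bold>1" "y \<oplus> z \<noteq> \<^bold>1" | "x \<oplus> y = \<^bold>1" "y \<oplus> z = \<^bold>1"
    | "x \<oplus> y \<noteq> \<^bold>1" "y \<oplus> z = \<^bold>1" | "x \<oplus> y = \<^bold>1" "y \<oplus> z \<noteq> \<^bold>1" by blast
  then show ?thesis
  proof cases
    case 1
    then have "y \<preceq> \<sim>x" "y \<preceq> \<sim>z" using x y z le_neg_of_plus_ne_one by (auto simp: plus_comm)
    then have "(x \<oplus> y) \<odot> z = x \<odot> (y \<oplus> z)" using x y z by (intro plus_times_swap_low)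
    then show ?thesis using 1 plus by (simp add: mult_chang_group)
  next
    case 2
    then have "(x \<odot> y) \<oplus> z = x \<oplus> (y \<odot> z)" using x y z by (intro plus_times_swap_high)
    then show ?thesis using 2 times by (simp add: mult_chang_group)
  next
    case 3
    then have "y \<preceq> \<sim>x" using x y le_neg_of_plus_ne_one by auto
    then have "(x \<oplus> y) \<odot> z = x \<oplus> (y \<odot> z)" using x y z 3 by (intro plus_times_swap_mixed)
    moreover from this have "x \<oplus> (y \<odot> z) \<noteq> \<^bold>1" using x y z times_eq_one_iff[of "x \<oplus> y" z] by simp
    moreover have "x \<oplus> y \<oplus> z = \<^bold>1" using plus 3 x by simp
    ultimately show ?thesis using 3 by (simp add: mult_chang_group)
  next
    case 4
    then have "y \<preceq> \<sim>z" "y \<oplus> x = \<^bold>1" using x y z le_neg_of_plus_ne_one[of z y] by (auto simp: plus_comm)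
    then have "(z \<oplus> y) \<odot> x = z \<oplus> (y \<odot> x)" using x y z by (intro plus_times_swap_mixed)
    then have eq: "x \<odot> (y \<oplus> z) = (x \<odot> y) \<oplus> z"
      using x y z by (simp add: plus_comm)
    moreover from this have "(x \<odot> y) \<oplus> z \<noteq> \<^bold>1" using x y z times_eq_one_iff[of x "y \<oplus> z"] by simp
    moreover have "x \<oplus> (y \<oplus> z) = \<^bold>1" using plus 4 z by simp
    ultimately show ?thesis using 4 by (simp add: mult_chang_group)
  qed
qed

lemma comm_group_chang_group: "comm_group chang_group"
proof (rule comm_groupI)
  fix g h assume "g \<in> carrier chang_group" "h \<in> carrier chang_group"
  then obtain i x j y where g: "g = (i, x)" "x \<in> carrier A" "x \<noteq> \<^bold>1"
    and h: "h = (j, y)" "y \<in> carrier A" "y \<noteq> \<^bold>1" by (auto simp: carrier_chang_group)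
  show "g \<otimes>\<^bsub>chang_group\<^esub> h \<in> carrier chang_group"
    using g h times_eq_one_iff[of x y] by (simp add: mult_chang_group carrier_chang_group)
  show "g \<otimes>\<^bsub>chang_group\<^esub> h = h \<otimes>\<^bsub>chang_group\<^esub> g"
    using g h plus_comm[of x y] times_comm[of x y] by (simp add: mult_chang_group)
next
  fix g assume g: "g \<in> carrier chang_group"
  then show "\<exists>h\<in>carrier chang_group. h \<otimes>\<^bsub>chang_group\<^esub> g = \<one>\<^bsub>chang_group\<^esub>" using chang_inv by blast
  show "\<one>\<^bsub>chang_group\<^esub> \<otimes>\<^bsub>chang_group\<^esub> g = g"
    using g by (auto simp: carrier_chang_group one_chang_group mult_chang_group split: if_splits)
next
  fix g h k assume "g \<in> carrier chang_group" "h \<in> carrier chang_group" "k \<in> carrier chang_group"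
  then show "g \<otimes>\<^bsub>chang_group\<^esub> h \<otimes>\<^bsub>chang_group\<^esub> k = g \<otimes>\<^bsub>chang_group\<^esub> (h \<otimes>\<^bsub>chang_group\<^esub> k)"
    using chang_assoc[of "snd g" "snd h" "snd k" "fst g" "fst h" "fst k"]
    by (simp add: carrier_chang_group mem_Times_iff)
qed (use nontrivial in \<open>simp add: carrier_chang_group one_chang_group\<close>)

sublocale G: comm_group chang_group
  by (rule comm_group_chang_group)

lemma inv_chang_group: "g \<in> carrier chang_group \<Longrightarrow> inv\<^bsub>chang_group\<^esub> g = chang_inv g"
  using chang_inv by (intro G.inv_equality)

text \<open>This is the positive cone of the lexicographic order, because \<open>0\<close> is the least element of \<open>A\<close>.\<close>

abbreviation nonneg :: "int \<times> 'a \<Rightarrow> bool" where "nonneg g \<equiv> 0 \<le> fst g"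

lemma fst_mult_ge: "fst g + fst h \<le> fst (g \<otimes>\<^bsub>chang_group\<^esub> h)"
  by (cases g; cases h) (simp add: mult_chang_group)

lemma nonneg_total: "g \<in> carrier chang_group \<Longrightarrow> nonneg g \<or> nonneg (inv\<^bsub>chang_group\<^esub> g)"
  by (cases g) (auto simp: inv_chang_group chang_inv_def)

lemma nonneg_antisym:
  "g \<in> carrier chang_group \<Longrightarrow> nonneg g \<Longrightarrow> nonneg (inv\<^bsub>chang_group\<^esub> g) \<Longrightarrow> g = \<one>\<^bsub>chang_group\<^esub>"
  by (cases g) (auto simp: inv_chang_group chang_inv_def one_chang_group split: if_splits)

definition unit :: "int \<times> 'a" where "unit = (1, \<zero>)"

definition embed :: "'a \<Rightarrow> int \<times> 'a" where "embed x = (if x = \<^bold>1 then unit else (0, x))"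

lemma unit_closed [simp]: "unit \<in> carrier chang_group"
  using nontrivial by (simp add: unit_def carrier_chang_group)

lemma embed_closed [simp]: "x \<in> carrier A \<Longrightarrow> embed x \<in> carrier chang_group"
  by (simp add: embed_def) (simp add: carrier_chang_group)

lemma embed_one: "embed \<^bold>1 = unit" by (simp add: embed_def)

lemma embed_zero: "embed \<zero> = \<one>\<^bsub>chang_group\<^esub>"
  using nontrivial by (simp add: embed_def one_chang_group)

lemma nonneg_embed: "nonneg (embed x)"
  by (simp add: embed_def unit_def)

lemma inj_embed: "embed x = embed y \<Longrightarrow> x = y"
  by (auto simp: embed_def unit_def split: if_splits)

lemma embed_plus_low:
  assumes "x \<in> carrier A" "y \<in> carrier A" "x \<oplus> y \<noteq> \<^bold>1"
  shows "embed (x \<oplus> y) = embed x \<otimes>\<^bsub>chang_group\<^esub> embed y"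
  using assms by (auto simp: embed_def mult_chang_group)

lemma embed_plus_high:
  assumes "x \<in> carrier A" "y \<in> carrier A" "x \<oplus> y = \<^bold>1"
  shows "embed x \<otimes>\<^bsub>chang_group\<^esub> embed y = unit \<otimes>\<^bsub>chang_group\<^esub> embed (x \<odot> y)"
  using assms times_eq_one_iff[of x y] nontrivial
  by (auto simp: embed_def mult_chang_group unit_def)

lemma embed_neg:
  assumes "x \<in> carrier A" shows "embed (\<sim>x) = unit \<otimes>\<^bsub>chang_group\<^esub> inv\<^bsub>chang_group\<^esub> (embed x)"
proof -
  have "embed (\<sim>x) \<otimes>\<^bsub>chang_group\<^esub> embed x = unit"
    using embed_plus_high[of "\<sim>x" x] assms by (simp add: embed_zero)
  then show ?thesis using G.inv_solve_right assms by simp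
qed

lemma not_nonneg_minus_unit:
  assumes "x \<in> carrier A" "x \<noteq> \<^bold>1"
  shows "\<not> nonneg (embed x \<otimes>\<^bsub>chang_group\<^esub> inv\<^bsub>chang_group\<^esub> unit)"
  using assms by (simp add: embed_def inv_chang_group) (simp add: unit_def chang_inv_def mult_chang_group)

end

context comm_group
begin

primrec lin_comb :: "(nat \<Rightarrow> 'a) \<Rightarrow> nat \<Rightarrow> (nat \<Rightarrow> int) \<Rightarrow> 'a" where
  "lin_comb x 0 c = \<one>"
| "lin_comb x (Suc k) c = lin_comb x k c \<otimes> x k [^] c k"

context
  fixes x :: "nat \<Rightarrow> 'a" assumes x [simp]: "\<And>i. x i \<in> carrier G"
begin

lemma lin_comb_closed [simp]: "lin_comb x k c \<in> carrier G"
  by (induction k) auto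

lemma lin_comb_add: "lin_comb x k (\<lambda>i. c i + d i) = lin_comb x k c \<otimes> lin_comb x k d"
  by (induction k) (auto simp: int_pow_mult m_ac)

lemma lin_comb_zero: "lin_comb x k (\<lambda>_. 0) = \<one>"
  by (induction k) auto

lemma lin_comb_neg: "lin_comb x k (\<lambda>i. - c i) = inv (lin_comb x k c)"
proof -
  have "lin_comb x k (\<lambda>i. - c i) \<otimes> lin_comb x k c = \<one>"
    unfolding lin_comb_add[symmetric] by (simp add: lin_comb_zero)
  then show ?thesis by (simp add: inv_equality)
qed

lemma lin_comb_diff: "lin_comb x k (\<lambda>i. c i - d i) = lin_comb x k c \<otimes> inv (lin_comb x k d)"
  using lin_comb_add[of k c "\<lambda>i. - d i"] by (simp add: lin_comb_neg)

lemma lin_comb_delta: "lin_comb x k (\<lambda>i. if i = j then 1 else 0) = (if j < k then x j else \<one>)"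
  by (induction k) (auto simp: less_Suc_eq)

end

end

section \<open>Transfer to Komori chains\<close>

definition delta :: "nat \<Rightarrow> nat \<Rightarrow> int" where "delta j = (\<lambda>i. if i = j then 1 else 0)"

lemma sum_delta: "(\<Sum>i<k. delta j i * y i) = (if j < k then y j else 0)"
  by (simp add: delta_def if_distrib[of "\<lambda>a. a * _"] cong: if_cong)

lemma finite_vars: "finite (vars t)"
  by (induction t) auto

context mv_chain
begin

text \<open>Index \<open>0\<close> belongs to the unit, index \<open>j + 1\<close> to the variable \<open>j\<close>.\<close>

definition generators :: "(nat \<Rightarrow> 'a) \<Rightarrow> nat \<Rightarrow> int \<times> 'a" where
  "generators f = case_nat unit (\<lambda>j. embed (f j))"

text \<open>The linear piece of the piecewise linear function \<open>t\<close> that is active at \<open>f\<close>: at each \<open>\<oplus>\<close> either the sum of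
the forms of the summands or, if the sum reaches the top, the unit.\<close>

primrec linear_form :: "(nat \<Rightarrow> 'a) \<Rightarrow> nat mv_term \<Rightarrow> nat \<Rightarrow> int" where
  "linear_form f (Var j) = delta (Suc j)"
| "linear_form f Zero = (\<lambda>_. 0)"
| "linear_form f (Plus s t) = (if mv_eval A f s \<oplus> mv_eval A f t = \<^bold>1 then delta 0
    else (\<lambda>i. linear_form f s i + linear_form f t i))"
| "linear_form f (Neg s) = (\<lambda>i. delta 0 i - linear_form f s i)"

definition excess :: "(nat \<Rightarrow> 'a) \<Rightarrow> nat mv_term \<Rightarrow> nat mv_term \<Rightarrow> nat \<Rightarrow> int" where
  "excess f s t = (\<lambda>i. linear_form f s i + linear_form f t i - delta 0 i)"

text \<open>The excesses of the sums in \<open>t\<close> over the unit; their signs decide which linear piece is active.\<close>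

primrec branch_tests :: "(nat \<Rightarrow> 'a) \<Rightarrow> nat mv_term \<Rightarrow> (nat \<Rightarrow> int) set" where
  "branch_tests f (Var j) = {}"
| "branch_tests f Zero = {}"
| "branch_tests f (Plus s t) = insert (excess f s t) (branch_tests f s \<union> branch_tests f t)"
| "branch_tests f (Neg s) = branch_tests f s"

lemma finite_branch_tests: "finite (branch_tests f t)"
  by (induction t) auto

lemma linear_form_support: "vars t \<subseteq> {..<k} \<Longrightarrow> i \<ge> Suc k \<Longrightarrow> linear_form f t i = 0"
  by (induction t) (auto simp: delta_def)

lemma branch_tests_support:
  "vars t \<subseteq> {..<k} \<Longrightarrow> i \<ge> Suc k \<Longrightarrow> c \<in> branch_tests f t \<Longrightarrow> c i = 0"
  by (induction t) (auto simp: delta_def linear_form_support excess_def)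

context
  fixes f :: "nat \<Rightarrow> 'a" assumes f: "f \<in> UNIV \<rightarrow> carrier A"
begin

lemma eval_closed [simp]: "mv_eval A f t \<in> carrier A"
  by (rule mv_eval_closed[OF mv_algebra_axioms f])

lemma generators_closed [simp]: "generators f i \<in> carrier chang_group"
  using embed_closed[of "f _"] f by (cases i) (auto simp: generators_def Pi_iff)

lemma lin_comb_delta_generators:
  "j < k \<Longrightarrow> G.lin_comb (generators f) k (delta j) = generators f j"
  by (simp add: delta_def G.lin_comb_delta)

lemma lin_comb_linear_form:
  "vars t \<subseteq> {..<k} \<Longrightarrow> G.lin_comb (generators f) (Suc k) (linear_form f t) = embed (mv_eval A f t)"
proof (induction t)
  case (Var j)
  then have "Suc j < Suc k" by simp
  from lin_comb_delta_generators[OF this] show ?case by (simp add: generators_def)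
next
  case (Neg s)
  have "G.lin_comb (generators f) (Suc k) (delta 0) = unit"
    using lin_comb_delta_generators[of 0 "Suc k"] by (simp add: generators_def)
  then show ?case using Neg by (simp only: linear_form.simps G.lin_comb_diff generators_closed) (simp add: embed_neg)
next
  case (Plus s t)
  have "G.lin_comb (generators f) (Suc k) (delta 0) = unit"
    using lin_comb_delta_generators[of 0 "Suc k"] by (simp add: generators_def)
  then show ?case using Plus
    by (simp only: linear_form.simps G.lin_comb_add generators_closed split: if_split)
      (simp add: embed_one embed_plus_low)
qed (simp only: linear_form.simps G.lin_comb_zero generators_closed mv_eval.simps embed_zero)

lemma nonneg_excess_iff:
  assumes "vars s \<subseteq> {..<k}" "vars t \<subseteq> {..<k}"
  shows "nonneg (G.lin_comb (generators f) (Suc k) (excess f s t)) \<longleftrightarrow>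
    mv_eval A f s \<oplus> mv_eval A f t = \<^bold>1"
proof -
  let ?s = "mv_eval A f s" and ?t = "mv_eval A f t"
  have "G.lin_comb (generators f) (Suc k) (delta 0) = unit"
    using lin_comb_delta_generators[of 0 "Suc k"] by (simp add: generators_def)
  then have eq: "G.lin_comb (generators f) (Suc k) (excess f s t) =
      embed ?s \<otimes>\<^bsub>chang_group\<^esub> embed ?t \<otimes>\<^bsub>chang_group\<^esub> inv\<^bsub>chang_group\<^esub> unit"
    unfolding excess_def
    by (simp only: G.lin_comb_diff G.lin_comb_add generators_closed lin_comb_linear_form assms)
  show ?thesis
  proof (cases "?s \<oplus> ?t = \<^bold>1")
    case True
    then have "embed ?s \<otimes>\<^bsub>chang_group\<^esub> embed ?t \<otimes>\<^bsub>chang_group\<^esub> inv\<^bsub>chang_group\<^esub> unit = embed (?s \<odot> ?t)"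
      using G.m_comm[of unit "embed (?s \<odot> ?t)"] by (simp add: embed_plus_high G.inv_solve_right')
    then show ?thesis using True nonneg_embed eq by simp
  next
    case False
    then show ?thesis using not_nonneg_minus_unit[of "?s \<oplus> ?t"] eq by (simp add: embed_plus_low)
  qed
qed

end

end

text \<open>A homomorphism \<open>r\<close> to the Lukasiewicz chain \<open>{0, ..., n}\<close>.\<close>

locale graded_chain = mv_chain +
  fixes r :: "'a \<Rightarrow> nat" and n :: nat
  assumes n_pos: "n > 0"
    and r_zero: "r \<zero> = 0"
    and r_neg: "x \<in> carrier A \<Longrightarrow> r x + r (mv_neg A x) = n"
    and r_plus: "x \<in> carrier A \<Longrightarrow> y \<in> carrier A \<Longrightarrow> r (x \<oplus> y) = min n (r x + r y)"
begin

lemma r_le: "x \<in> carrier A \<Longrightarrow> r x \<le> n"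
  using r_neg[of x] by simp

lemma r_one: "r \<^bold>1 = n"
  using r_neg[of \<zero>] r_zero by simp

lemma r_mono:
  assumes "x \<in> carrier A" "y \<in> carrier A" "x \<preceq> y" shows "r x \<le> r y"
  using r_plus[of "y \<ominus> x" x] minus_plus_of_le[of x y] assms r_le[of x] by simp

text \<open>The extension of \<open>r\<close> to a homomorphism from the Chang group to \<open>\<int>\<close>, which takes the unit to \<open>n\<close>.\<close>

definition grade :: "int \<times> 'a \<Rightarrow> int" where "grade g = fst g * int n + int (r (snd g))"

lemma grade_mult:
  assumes "g \<in> carrier chang_group" "h \<in> carrier chang_group"
  shows "grade (g \<otimes>\<^bsub>chang_group\<^esub> h) = grade g + grade h"
proof -
  obtain i x j y where g: "g = (i, x)" "x \<in> carrier A" and h: "h = (j, y)" "y \<in> carrier A"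
    using assms by (auto simp: carrier_chang_group)
  show ?thesis
  proof (cases "x \<oplus> y = \<^bold>1")
    case True
    then have le: "n \<le> r x + r y" using r_plus[of x y] g h r_one by simp
    have "r (x \<odot> y) + r (\<sim>x \<oplus> \<sim>y) = n" using g h r_neg[of "\<sim>x \<oplus> \<sim>y"] by simp
    then have "int (r (x \<odot> y)) = int (r x) + int (r y) - int n"
      using r_plus[of "\<sim>x" "\<sim>y"] r_neg[of x] r_neg[of y] g h le by simp
    then show ?thesis using True g h by (simp add: mult_chang_group grade_def algebra_simps)
  next
    case False
    then have "r y \<le> r (\<sim>x)" using g h le_neg_of_plus_ne_one r_mono by simp
    then have "r (x \<oplus> y) = r x + r y" using r_plus[of x y] r_neg[of x] g h by simp
    then show ?thesis using False g h by (simp add: mult_chang_group grade_def algebra_simps)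
  qed
qed

lemma grade_one: "grade \<one>\<^bsub>chang_group\<^esub> = 0"
  by (simp add: grade_def one_chang_group r_zero)

lemma grade_inv: "g \<in> carrier chang_group \<Longrightarrow> grade (inv\<^bsub>chang_group\<^esub> g) = - grade g"
  using grade_mult[of g "inv\<^bsub>chang_group\<^esub> g"] grade_one by simp

lemma grade_nat_pow:
  "g \<in> carrier chang_group \<Longrightarrow> grade (g [^]\<^bsub>chang_group\<^esub> (z :: nat)) = int z * grade g"
  by (induction z) (auto simp: grade_mult grade_one algebra_simps)

lemma grade_int_pow:
  "g \<in> carrier chang_group \<Longrightarrow> grade (g [^]\<^bsub>chang_group\<^esub> (z :: int)) = z * grade g"
  by (simp add: int_pow_def2 grade_inv grade_nat_pow del: pow_nat)

lemma grade_lin_comb: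
  "(\<And>i. x i \<in> carrier chang_group) \<Longrightarrow> grade (G.lin_comb x k c) = (\<Sum>i<k. c i * grade (x i))"
  by (induction k) (simp_all add: grade_one grade_mult grade_int_pow)

lemma grade_pos: "g \<in> carrier chang_group \<Longrightarrow> grade g > 0 \<Longrightarrow> nonneg g"
proof (rule ccontr)
  assume g: "g \<in> carrier chang_group" "grade g > 0" "\<not> nonneg g"
  then have "fst g * int n \<le> (- 1) * int n" by (intro mult_right_mono) auto
  moreover have "r (snd g) \<le> n" using g r_le by (auto simp: carrier_chang_group)
  ultimately show False using g by (simp add: grade_def)
qed

lemma grade_nonneg: "nonneg g \<Longrightarrow> grade g \<ge> 0"
  by (simp add: grade_def)

lemma grade_unit: "grade unit = int n"
  by (simp add: grade_def unit_def r_zero)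

text \<open>A nonzero grade decides the sign of an element. To compare elements of grade zero, every form \<open>c\<close> is
replaced by \<open>T c\<close>, which is \<open>n c\<close> minus the multiple of the unit that has the same grade; the signs of the \<open>T c\<close>
are again those of a total preorder, and \<open>integer_point\<close> realizes them by integers \<open>y\<close>. The unit itself
becomes zero, so \<open>y 0 = 0\<close>, as the unit \<open>(m, 0)\<close> of \<open>K\<^sub>m\<close> requires. The factor \<open>q\<close> embeds \<open>K\<^sub>n\<close> into \<open>K\<^sub>q\<^sub>n\<close>.\<close>

lemma lexicographic_point:
  assumes x: "\<And>i. x i \<in> carrier chang_group" and x0: "x 0 = unit" and k: "k > 0"
    and L: "finite L" and supp: "\<And>c i. c \<in> L \<Longrightarrow> i \<ge> k \<Longrightarrow> c i = 0" and q: "q > 0"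
  shows "\<exists>y. y 0 = 0 \<and> (\<forall>c\<in>L. nonneg (G.lin_comb x k c) \<longleftrightarrow>
    (0, 0) \<le> (int q * (\<Sum>i<k. c i * grade (x i)), \<Sum>i<k. c i * y i))"
proof -
  define R where "R c = (\<Sum>i<k. c i * grade (x i))" for c
  define T where "T c = (\<lambda>i. int n * c i - R c * delta 0 i)" for c
  define N where "N c \<longleftrightarrow> nonneg (G.lin_comb x k c)" for c
  note [simp] = x
  interpret N: vector_preorder N
  proof
    show "N c \<or> N (\<lambda>i. - c i)" for c
      using nonneg_total[of "G.lin_comb x k c"] by (simp add: N_def G.lin_comb_neg)
    show "N (\<lambda>i. c i + d i)" if "N c" "N d" for c d
      using that fst_mult_ge[of "G.lin_comb x k c" "G.lin_comb x k d"] by (simp add: N_def G.lin_comb_add)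
  qed
  have Rn: "R (\<lambda>i. - c i) = - R c" and Ra: "R (\<lambda>i. c i + d i) = R c + R d" for c d
    by (simp_all add: R_def sum_negf sum.distrib algebra_simps)
  interpret T: vector_preorder "\<lambda>c. N (T c)"
  proof
    show "N (T c) \<or> N (T (\<lambda>i. - c i))" for c
      using N.total[of "T c"] by (simp add: T_def Rn algebra_simps)
    show "N (T (\<lambda>i. c i + d i))" if "N (T c)" "N (T d)" for c d
      using N.add[OF that] by (simp add: T_def Ra algebra_simps)
  qed
  let ?L = "L \<union> {delta 0, \<lambda>i. - delta 0 i}"
  have "\<exists>y. \<forall>c\<in>?L. N (T c) \<longleftrightarrow> 0 \<le> (\<Sum>i<k. c i * y i)"
  proof (rule T.integer_point)
    show "c i = 0" if "c \<in> ?L" "i \<ge> k" for c i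
      using that supp[of c i] k by (auto simp: delta_def)
  qed (use L in simp)
  then obtain y where y: "\<And>c. c \<in> ?L \<Longrightarrow> N (T c) \<longleftrightarrow> 0 \<le> (\<Sum>i<k. c i * y i)" by blast
  have R0: "R (delta 0) = int n" using k x0 by (simp add: R_def sum_delta grade_unit)
  have "T (delta 0) = (\<lambda>_. 0)" "T (\<lambda>i. - delta 0 i) = (\<lambda>_. 0)" by (simp_all add: T_def R0 Rn)
  then have y0: "y 0 = 0"
    using y[of "delta 0"] y[of "\<lambda>i. - delta 0 i"] N.zero k by (simp add: sum_delta sum_negf)
  have gr: "grade (G.lin_comb x k c) = R c" for c by (simp add: grade_lin_comb R_def)
  have "N c \<longleftrightarrow> (0, 0) \<le> (int q * R c, \<Sum>i<k. c i * y i)" if c: "c \<in> L" for c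
  proof -
    consider "R c > 0" | "R c < 0" | "R c = 0" by linarith
    then show ?thesis
    proof cases
      case 1
      then have "N c" using grade_pos[of "G.lin_comb x k c"] gr by (simp add: N_def)
      then show ?thesis using 1 q by (simp add: less_eq_prod_def)
    next
      case 2
      then have "\<not> N c" using grade_nonneg[of "G.lin_comb x k c"] gr[of c] unfolding N_def by linarith
      moreover have "int q * R c < 0" using 2 q by (simp add: mult_pos_neg)
      ultimately show ?thesis by (simp add: less_eq_prod_def)
    next
      case 3
      then have "N (T c) \<longleftrightarrow> N c" using N.scale_iff[of "int n" c] n_pos by (simp add: T_def)
      then show ?thesis using 3 y[of c] c by (simp add: less_eq_prod_def)
    qed
  qed
  then show ?thesis using y0 unfolding N_def R_def by blast
qed

text \<open>Given values \<open>f\<close> of the variables in \<open>A\<close>, the values \<open>g\<close> in \<open>K\<^sub>q\<^sub>n\<close> are chosen such that finitely many linear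
forms keep their signs: the branch tests of both terms, so that the same linear pieces are active at \<open>g\<close> as
at \<open>f\<close>; the forms \<open>x\<^sub>j\<close> and \<open>u - x\<^sub>j\<close>, so that \<open>g\<close> has values in \<open>K\<^sub>q\<^sub>n\<close>; and the difference \<open>d\<close> of the two
active pieces, so that the terms agree at \<open>f\<close> if they agree at \<open>g\<close>.\<close>

lemma satisfies_if_Komori_satisfies:
  assumes q: "q > 0" and E: "satisfies (Komori (q * n)) E"
  shows "satisfies A E"
  unfolding satisfies_def
proof safe
  fix s t and f :: "nat \<Rightarrow> 'a" assume st: "(s, t) \<in> E" and f: "f \<in> UNIV \<rightarrow> carrier A"
  define m where "m = q * n"
  obtain k where k: "vars s \<union> vars t \<subseteq> {..<k}"
    using finite_nat_set_iff_bounded[of "vars s \<union> vars t"] finite_vars by (metis finite_Un lessThan_iff subsetI)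
  define e where "e = G.lin_comb (generators f) (Suc k)"
  have gc: "generators f i \<in> carrier chang_group" for i using generators_closed[OF f] .
  have e_closed: "e c \<in> carrier chang_group" for c
    unfolding e_def using gc by (rule G.lin_comb_closed)
  have e_diff: "e (\<lambda>i. c i - c' i) = e c \<otimes>\<^bsub>chang_group\<^esub> inv\<^bsub>chang_group\<^esub> e c'" for c c'
    unfolding e_def using gc by (rule G.lin_comb_diff)
  have e_neg: "e (\<lambda>i. - c i) = inv\<^bsub>chang_group\<^esub> e c" for c
    unfolding e_def using gc by (rule G.lin_comb_neg)
  have e_delta: "e (delta j) = generators f j" if "j \<le> k" for j
    unfolding e_def using that by (intro lin_comb_delta_generators[OF f]) simp
  have e_form: "e (linear_form f u) = embed (mv_eval A f u)" if "vars u \<subseteq> {..<k}" for u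
    unfolding e_def using that by (rule lin_comb_linear_form[OF f])
  define d where "d = (\<lambda>i. linear_form f s i - linear_form f t i)"
  define L where "L = branch_tests f s \<union> branch_tests f t \<union> {d, \<lambda>i. - d i} \<union>
    (\<Union>j<k. {delta (Suc j), \<lambda>i. delta 0 i - delta (Suc j) i})"
  have "\<exists>y. y 0 = 0 \<and> (\<forall>c\<in>L. nonneg (e c) \<longleftrightarrow>
    (0, 0) \<le> (int q * (\<Sum>i<Suc k. c i * grade (generators f i)), \<Sum>i<Suc k. c i * y i))"
    unfolding e_def
  proof (rule lexicographic_point)
    show "c i = 0" if "c \<in> L" "i \<ge> Suc k" for c i
      using that k branch_tests_support[of s k i c f] branch_tests_support[of t k i c f]
        linear_form_support[of s k i f] linear_form_support[of t k i f]
      by (auto simp: L_def delta_def d_def)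
  qed (use q gc finite_branch_tests in \<open>auto simp: L_def generators_def\<close>)
  then obtain y where y0: "y 0 = 0" and y: "\<And>c. c \<in> L \<Longrightarrow> nonneg (e c) \<longleftrightarrow>
    (0, 0) \<le> (int q * (\<Sum>i<Suc k. c i * grade (generators f i)), \<Sum>i<Suc k. c i * y i)"
    by blast
  define V where "V c = (int q * (\<Sum>i<Suc k. c i * grade (generators f i)), \<Sum>i<Suc k. c i * y i)" for c
  have V: "c \<in> L \<Longrightarrow> nonneg (e c) \<longleftrightarrow> 0 \<le> V c" for c
    using y by (simp only: V_def zero_prod_def)
  have Vadd: "V (\<lambda>i. c i + c' i) = V c + V c'" and Vdiff: "V (\<lambda>i. c i - c' i) = V c - V c'"
    and Vneg: "V (\<lambda>i. - c i) = - V c" for c c'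
    by (simp_all only: V_def sum.distrib sum_subtractf sum_negf distrib_right left_diff_distrib
        distrib_left right_diff_distrib mult_minus_left mult_minus_right add_Pair diff_Pair uminus_Pair)
  have V0: "V (\<lambda>_. 0) = 0" by (simp add: V_def zero_prod_def)
  have Vd: "V (delta j) = (int q * grade (generators f j), y j)" if "j \<le> k" for j
    using that unfolding V_def sum_delta by simp
  have Vu: "V (delta 0) = (int m, 0)"
    using Vd[of 0] y0 by (simp add: generators_def grade_unit m_def)
  define g where "g j = (if j < k then V (delta (Suc j)) else 0)" for j
  have gK: "g j \<in> carrier (Komori m)" for j
  proof (cases "j < k")
    case True
    have fj: "f j \<in> carrier A" using f by auto
    have "e (delta (Suc j)) = embed (f j)" "e (delta 0) = unit"
      using True by (simp_all add: e_delta generators_def)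
    then have "nonneg (e (delta (Suc j)))" "nonneg (e (\<lambda>i. delta 0 i - delta (Suc j) i))"
      using nonneg_embed fj by (simp_all only: e_diff embed_neg[symmetric])
    moreover have "delta (Suc j) \<in> L" "(\<lambda>i. delta 0 i - delta (Suc j) i) \<in> L"
      using True by (auto simp: L_def)
    ultimately have "0 \<le> g j" "g j \<le> (int m, 0)"
      using V[of "delta (Suc j)"] V[of "\<lambda>i. delta 0 i - delta (Suc j) i"] True
      by (simp_all add: g_def Vdiff Vu)
    then show ?thesis by (simp add: Komori_def Gamma_def)
  qed (simp add: g_def carrier_Komori)
  have eval: "mv_eval (Komori m) g u = V (linear_form f u)"
    if "branch_tests f u \<subseteq> L" "vars u \<subseteq> {..<k}" for u
    using that
  proof (induction u)
    case (Plus u v)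
    then have IH: "mv_eval (Komori m) g u = V (linear_form f u)" "mv_eval (Komori m) g v = V (linear_form f v)"
      by simp_all
    have "excess f u v \<in> L" using Plus by simp
    then have "mv_eval A f u \<oplus> mv_eval A f v = \<^bold>1 \<longleftrightarrow> 0 \<le> V (excess f u v)"
      using V[of "excess f u v"] nonneg_excess_iff[OF f, of u k v, folded e_def] Plus by simp
    also have "V (excess f u v) = V (linear_form f u) + V (linear_form f v) - (int m, 0)"
      by (simp only: excess_def Vdiff Vadd Vu)
    finally show ?case
      by (simp add: IH plus_Komori Vu Vadd min_def not_le less_imp_le)
  next
    case (Neg u)
    then show ?case by (simp add: neg_Komori Vdiff Vu)
  next
    case (Var j)
    then show ?case by (simp add: g_def)
  qed (simp only: linear_form.simps V0 mv_eval.simps zero_Komori)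
  have "mv_eval (Komori m) g s = mv_eval (Komori m) g t"
    using E st gK by (auto simp: satisfies_def m_def)
  moreover have "branch_tests f s \<subseteq> L" "branch_tests f t \<subseteq> L" by (auto simp: L_def)
  ultimately have "V d = 0" using eval[of s] eval[of t] k by (simp add: d_def Vdiff)
  moreover have "d \<in> L" "(\<lambda>i. - d i) \<in> L" by (auto simp: L_def)
  ultimately have "nonneg (e d)" "nonneg (inv\<^bsub>chang_group\<^esub> (e d))"
    using V[of d] V[of "\<lambda>i. - d i"] by (simp_all add: Vneg e_neg)
  then have "e d = \<one>\<^bsub>chang_group\<^esub>" using nonneg_antisym[OF e_closed] by blast
  moreover have "e d = embed (mv_eval A f s) \<otimes>\<^bsub>chang_group\<^esub> inv\<^bsub>chang_group\<^esub> (embed (mv_eval A f t))"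
    using k by (simp add: d_def e_diff e_form)
  ultimately have "embed (mv_eval A f s) = embed (mv_eval A f t)"
    using mv_eval_closed[OF mv_algebra_axioms f] by (metis G.inv_equality G.inv_inv G.inv_closed embed_closed)
  then show "mv_eval A f s = mv_eval A f t" by (rule inj_embed)
qed

end

text \<open>The chain is graded by the position of the radical class.\<close>

lemma satisfies_if_rank:
  assumes C: "mv_chain C" and rank: "has_rank C n" and n: "n > 0" and q: "q > 0"
    and E: "satisfies (Komori (q * n)) E"
  shows "satisfies C E"
proof -
  interpret C: mv_chain C by (rule C)
  define D where "D = mv_ideal_quot C (mv_Rad C)"
  interpret Q: mv_surj C D "\<lambda>x. ideal_cong C (mv_Rad C) `` {x}"
    unfolding D_def by (rule mv_surj_ideal_quot[OF C.mv_algebra_axioms C.Rad_ideal])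
  interpret D0: mv_algebra D by (rule Q.cod)
  let ?h = "\<lambda>x. ideal_cong C (mv_Rad C) `` {x}"
  have card: "card (carrier D) = n + 1"
    using rank by (simp add: has_rank_def radical_classes_def D_def)
  have "\<zero>\<^bsub>D\<^esub> \<noteq> mv_neg D \<zero>\<^bsub>D\<^esub>"
  proof
    assume "\<zero>\<^bsub>D\<^esub> = mv_neg D \<zero>\<^bsub>D\<^esub>"
    then have "u = \<zero>\<^bsub>D\<^esub>" if "u \<in> carrier D" for u
      using D0.le_one[OF that] D0.le_zero_iff[OF that] by simp
    then have "carrier D \<subseteq> {\<zero>\<^bsub>D\<^esub>}" by blast
    then have "card (carrier D) \<le> 1" using card_mono[of "{\<zero>\<^bsub>D\<^esub>}"] by simp
    then show False using card n by simp
  qed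
  then interpret D: mv_chain D by (rule Q.mv_chain_image[OF C])
  interpret D: finite_mv_chain D n by unfold_locales (rule card)
  interpret graded_chain C "\<lambda>x. D.position (?h x)" n
    by unfold_locales
      (simp_all only: n Q.hom_zero Q.hom_neg Q.hom_plus D.position_zero D.position_neg D.position_plus Q.hom_closed)
  show ?thesis by (rule satisfies_if_Komori_satisfies[OF q E])
qed

section \<open>The four conditions\<close>

text \<open>Two elements with a nonzero distance stay different modulo a prime ideal that avoids this distance, so
  every MV-algebra is a subdirect product of its prime quotients.\<close>

lemma satisfies_if_prime_quotients:
  assumes A: "mv_algebra A"
    and quot: "\<And>P. P \<in> mv_Spec A \<Longrightarrow> satisfies (mv_ideal_quot A P) E"
  shows "satisfies A E"
  unfolding satisfies_def
proof safe
  interpret mv_algebra A by (rule A)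
  fix s t and f :: "nat \<Rightarrow> 'a" assume st: "(s, t) \<in> E" and f: "f \<in> UNIV \<rightarrow> carrier A"
  let ?s = "mv_eval A f s" and ?t = "mv_eval A f t"
  have c: "?s \<in> carrier A" "?t \<in> carrier A" using mv_eval_closed[OF A f] by auto
  show "?s = ?t"
  proof (rule ccontr)
    assume "?s \<noteq> ?t"
    then have "dist ?s ?t \<notin> {\<zero>\<^bsub>A\<^esub>}" using c dist_zero_iff by simp
    moreover have "mv_ideal A {\<zero>\<^bsub>A\<^esub>}" by (simp add: mv_ideal_def)
    ultimately obtain P where av: "avoiding (dist ?s ?t) P" using ex_avoiding by blast
    then have P: "P \<in> mv_Spec A" using c avoiding_Spec[OF av] by simp
    then have id: "mv_ideal A P" by (simp add: mv_Spec_def)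
    interpret Q: mv_surj A "mv_ideal_quot A P" "\<lambda>x. ideal_cong A P `` {x}"
      by (rule mv_surj_ideal_quot[OF A id])
    have fQ: "(\<lambda>v. ideal_cong A P `` {f v}) \<in> UNIV \<rightarrow> carrier (mv_ideal_quot A P)"
      using f by (auto intro!: Q.hom_closed)
    have "ideal_cong A P `` {?s} = ideal_cong A P `` {?t}"
      using quot[OF P] st fQ unfolding satisfies_def Q.hom_eval[OF f, symmetric] by blast
    then have "(?s, ?t) \<in> ideal_cong A P" using eq_equiv_class[OF _ ideal_cong_equiv[OF id] c(2)] by blast
    then have "dist ?s ?t \<in> P" by (simp add: ideal_cong_def)
    then show False using av by (simp add: avoiding_def)
  qed
qed

lemma in_variety_of_Komori_if_Spec:
  assumes A: "mv_algebra A" and m: "m > 0"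
    and rank: "\<And>P. P \<in> mv_Spec A \<Longrightarrow> \<exists>n. ideal_has_rank A P n \<and> n dvd m"
  shows "in_variety_of (Komori m) A"
  unfolding in_variety_of_def
proof (intro conjI A allI impI satisfies_if_prime_quotients[OF A])
  fix E P assume E: "satisfies (Komori m) E" and P: "P \<in> mv_Spec A"
  obtain n q where n: "has_rank (mv_ideal_quot A P) n" "m = q * n"
    using rank[OF P] by (auto simp: ideal_has_rank_def dvd_def mult.commute)
  then show "satisfies (mv_ideal_quot A P) E"
    using m E satisfies_if_rank[OF mv_chain_prime_quot[OF A P] n(1), of q] by simp
qed

lemma Spec_ranks_iff_Max_ranks:
  assumes A: "mv_algebra A"
  shows "(\<forall>P\<in>mv_Spec A. \<exists>n. ideal_has_rank A P n \<and> n dvd m) \<longleftrightarrow>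
    (\<forall>M\<in>mv_Max A. \<exists>n. ideal_has_rank A M n \<and> n dvd m)"
  using ideal_has_rank_Max_above[OF A] mv_algebra.ex_Max_above[OF A] mv_algebra.Max_subset_Spec[OF A]
  by (metis subsetD)

text \<open>A maximal ideal of the quotient is the image of a maximal ideal above \<open>I\<close>, with the same rank, and the
rank of a prime ideal is that of the maximal ideal above it.\<close>

lemma Max_ranks_iff_V_ranks:
  assumes F: "mv_algebra F" and I: "mv_ideal F I"
  shows "(\<forall>M\<in>mv_Max (mv_ideal_quot F I). \<exists>n. ideal_has_rank (mv_ideal_quot F I) M n \<and> n dvd m) \<longleftrightarrow>
    (\<forall>P\<in>mv_V F I. \<exists>n. ideal_has_rank F P n \<and> n dvd m)"
proof -
  let ?A = "mv_ideal_quot F I" and ?h = "\<lambda>x. ideal_cong F I `` {x}"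
  interpret F: mv_algebra F by (rule F)
  interpret Q: mv_surj F ?A ?h by (rule mv_surj_ideal_quot[OF F I])
  note ker = kernel_ideal_quot[OF F I]
  show ?thesis
  proof (intro iffI ballI)
    fix P assume rank: "\<forall>M\<in>mv_Max ?A. \<exists>n. ideal_has_rank ?A M n \<and> n dvd m" and "P \<in> mv_V F I"
    then have P: "P \<in> mv_Spec F" "I \<subseteq> P" by (simp_all add: mv_V_def)
    then obtain M where M: "M \<in> mv_Max F" "P \<subseteq> M" using F.ex_Max_above by blast
    then have hM: "(`) ?h M \<in> mv_Max ?A" using P ker by (intro Q.image_Max) auto
    have "Q.preimage (?h ` M) = M"
      using M P ker by (intro Q.preimage_image) (auto simp: mv_Max_def)
    then have "ideal_has_rank F P n \<longleftrightarrow> ideal_has_rank ?A (?h ` M) n" for n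
      using Q.ideal_has_rank_preimage[OF hM] ideal_has_rank_Max_above[OF F P(1) M] by simp
    then show "\<exists>n. ideal_has_rank F P n \<and> n dvd m" using rank hM by blast
  next
    fix M assume rank: "\<forall>P\<in>mv_V F I. \<exists>n. ideal_has_rank F P n \<and> n dvd m" and M: "M \<in> mv_Max ?A"
    then have "mv_ideal ?A M" by (simp add: mv_Max_def)
    then have "I \<subseteq> Q.preimage M" using Q.preimage_ideal(2) ker by simp
    then have "Q.preimage M \<in> mv_V F I"
      using Q.preimage_Max[OF M] F.Max_subset_Spec by (auto simp: mv_V_def)
    then show "\<exists>n. ideal_has_rank ?A M n \<and> n dvd m"
      using rank Q.ideal_has_rank_preimage[OF M] by blast
  qed
qed

theorem theorem10p6:
  fixes X :: "'k set" and I :: "'k mv_term set set" and m :: nat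
    and A :: "'k mv_term set set mv"
  assumes I: "mv_ideal (Free X) I"
    and A: "A = mv_ideal_quot (Free X) I"
    and m: "m > 0"
  shows
    "(in_variety_of (Komori m) A \<longleftrightarrow>
        (\<forall>P\<in>mv_Spec A. \<exists>n. ideal_has_rank A P n \<and> n dvd m)) \<and>
     ((\<forall>P\<in>mv_Spec A. \<exists>n. ideal_has_rank A P n \<and> n dvd m) \<longleftrightarrow>
        (\<forall>M\<in>mv_Max A. \<exists>n. ideal_has_rank A M n \<and> n dvd m)) \<and>
     ((\<forall>M\<in>mv_Max A. \<exists>n. ideal_has_rank A M n \<and> n dvd m) \<longleftrightarrow>
        (\<forall>P\<in>mv_V (Free X) I. \<exists>n. ideal_has_rank (Free X) P n \<and> n dvd m))"
proof -
  have alg: "mv_algebra A"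
    unfolding A using mv_surj.cod[OF mv_surj_ideal_quot[OF mv_algebra_Free I]] .
  have "in_variety_of (Komori m) A \<longleftrightarrow> (\<forall>P\<in>mv_Spec A. \<exists>n. ideal_has_rank A P n \<and> n dvd m)"
    using Max_rank_dvd[OF m alg] in_variety_of_Komori_if_Spec[OF alg m]
    unfolding Spec_ranks_iff_Max_ranks[OF alg, symmetric]
    using Spec_ranks_iff_Max_ranks[OF alg] by blast
  then show ?thesis
    using Spec_ranks_iff_Max_ranks[OF alg] Max_ranks_iff_V_ranks[OF mv_algebra_Free I]
    unfolding A by blast
qed

end
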